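(* For every $n\ge 0$, the functor $\mathfrak{B}^n\mathbb{F}_1\colon\mathrm{Fin}_\ast\to s^n\mathrm{Set}_\ast$ is isomorphic, as a $\Gamma$-object in $s^n\mathrm{Set}_\ast$ (that is, naturally in $\mathrm{Fin}_\ast$), to $(\mathfrak{S}^n)^{\vee}$.
   Context: $\mathrm{Fin}_\ast$ is the category of the finite pointed sets $\langle n\rangle=\{\ast,1,\dots,n\}$ (basepoint $\ast$) and pointed maps; the smash product is regarded as a functor $\wedge\colon\mathrm{Fin}_\ast\times\mathrm{Fin}_\ast\to\mathrm{Fin}_\ast$, $\langle a\rangle\wedge\langle b\rangle=\langle ab\rangle$ (using, e.g., the lexicographic ordering of pairs). A $\Gamma$-object in a pointed category $\mathcal{C}$ is a pointed (zero-object-preserving) functor $\mathrm{Fin}_\ast\to\mathcal{C}$. $\mathrm{Mod}_{\mathbb{F}_1}$ is the category of pointed functors $\mathrm{Fin}_\ast\to\mathrm{Set}_\ast$, and $\mathbb{F}_1\in\mathrm{Mod}_{\mathbb{F}_1}$ is the inclusion $\mathrm{Fin}_\ast\hookrightarrow\mathrm{Set}_\ast$. For a category $\mathcal{C}$, $s^n\mathcal{C}$ denotes the category of functors $(\Delta^{\mathrm{op}})^n\to\mathcal{C}$; multidegree $[k_1,\dots,k_n]$ means the object $([k_1],\dots,[k_n])$. An object of $s^n\mathrm{Mod}_{\mathbb{F}_1}$ is regarded equivalently as a functor $(\Delta^{\mathrm{op}})^n\times\mathrm{Fin}_\ast\to\mathrm{Set}_\ast$ or as a $\Gamma$-object $\mathrm{Fin}_\ast\to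 s^n\mathrm{Set}_\ast$. Let $\mathtt{s}\colon\Delta^{\mathrm{op}}\to\mathrm{Fin}_\ast$ be the pointed simplicial finite set $\Delta^1/\partial\Delta^1$, so $\mathtt{s}[n]=\langle n\rangle$. The delooping functor $\mathfrak{B}\colon s^n\mathrm{Mod}_{\mathbb{F}_1}\to s^{n+1}\mathrm{Mod}_{\mathbb{F}_1}$ is pullback along $\Delta^{\mathrm{op}}\times\mathrm{Fin}_\ast\xrightarrow{\mathtt{s}\times\mathrm{id}}\mathrm{Fin}_\ast\times\mathrm{Fin}_\ast\xrightarrow{\wedge}\mathrm{Fin}_\ast$ in the $\mathrm{Fin}_\ast$ variable, i.e. $(\mathfrak{B}X)([k_1,\dots,k_{n+1}],\langle m\rangle)=X([k_1,\dots,k_n],\langle k_{n+1}\rangle\wedge\langle m\rangle)$, and $\mathfrak{B}^n$ is its $n$-fold iterate (with $\mathfrak{B}^0=\mathrm{id}$). $\square^n\in s^n\mathrm{Set}$ is the free $n$-fold simplicial set on one element in multidegree $[1,1,\dots,1]$ (the functor represented by $([1],\dots,[1])$), $\partial\square^n\subset\square^n$ is the sub-$n$-fold simplicial set generated by all its faces, and $\mathfrak{S}^n=\square^n/\partial\square^n\in s^n\mathrm{Set}_\ast$, pointed by the image of $\partial\square^n$ (for $n=0$, the quotient by the empty set means adjoining a basepoint). For a category $\mathcal{C}$ with finite coproducts and terminal object and a pointed object $X$, let $\bigvee$ denote the coproduct of pointed objects. $X^\vee$ is the coproduct-preserving functor on $\mathrm{Fin}_\ast$ (here regarded as taking values in pointed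 objects) with $\langle k\rangle\mapsto\bigvee_k X$ which encodes the commutative monoid structure on $X$ given by the pointing $\ast\to X$ and the fold map $X\vee X\to X$: for $\phi\colon\langle k\rangle\to\langle l\rangle$, $X^\vee(\phi)$ maps the $i$-th summand by the identity onto the $\phi(i)$-th summand if $\phi(i)\neq\ast$, and to the basepoint if $\phi(i)=\ast$. *)

theory Defs
  imports Main "HOL-Library.FuncSet"
begin

section \<open>Categories, set-valued and pointed-set-valued functors\<close>

text \<open>\<open>Comp C a b c g f\<close> is the composite of \<open>f : a \<rightarrow> b\<close> followed by \<open>g : b \<rightarrow> c\<close>.\<close>

record ('o, 'm) category =
  Obj :: "'o set"
  Hom :: "'o \<Rightarrow> 'o \<Rightarrow> 'm set"
  Ident :: "'o \<Rightarrow> 'm"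
  Comp :: "'o \<Rightarrow> 'o \<Rightarrow> 'o \<Rightarrow> 'm \<Rightarrow> 'm \<Rightarrow> 'm"

definition is_category :: "('o, 'm) category \<Rightarrow> bool" where
  "is_category C \<longleftrightarrow>
     (\<forall>a\<in>Obj C. Ident C a \<in> Hom C a a) \<and>
     (\<forall>a\<in>Obj C. \<forall>b\<in>Obj C. \<forall>c\<in>Obj C. \<forall>f\<in>Hom C a b. \<forall>g\<in>Hom C b c.
        Comp C a b c g f \<in> Hom C a c) \<and>
     (\<forall>a\<in>Obj C. \<forall>b\<in>Obj C. \<forall>f\<in>Hom C a b.
        Comp C a a b f (Ident C a) = f \<and> Comp C a b b (Ident C b) f = f) \<and>
     (\<forall>a\<in>Obj C. \<forall>b\<in>Obj C. \<forall>c\<in>Obj C. \<forall>d\<in>Obj C.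
        \<forall>f\<in>Hom C a b. \<forall>g\<in>Hom C b c. \<forall>h\<in>Hom C c d.
        Comp C a c d h (Comp C a b c g f) = Comp C a b d (Comp C b c d h g) f)"

definition op_cat :: "('o, 'm) category \<Rightarrow> ('o, 'm) category" where
  "op_cat C = \<lparr>Obj = Obj C, Hom = (\<lambda>a b. Hom C b a), Ident = Ident C,
     Comp = (\<lambda>a b c g f. Comp C c b a f g)\<rparr>"

definition prod_cat ::
    "('o, 'm) category \<Rightarrow> ('p, 'k) category \<Rightarrow> ('o \<times> 'p, 'm \<times> 'k) category" where
  "prod_cat C D = \<lparr>Obj = Obj C \<times> Obj D,
     Hom = (\<lambda>a b. Hom C (fst a) (fst b) \<times> Hom D (snd a) (snd b)),
     Ident = (\<lambda>a. (Ident C (fst a), Ident D (snd a))),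
     Comp = (\<lambda>a b c g f. (Comp C (fst a) (fst b) (fst c) (fst g) (fst f),
                          Comp D (snd a) (snd b) (snd c) (snd g) (snd f)))\<rparr>"

text \<open>The \<open>n\<close>-fold power of a category; objects and morphisms are lists of length \<open>n\<close>.\<close>

definition pow_cat :: "nat \<Rightarrow> ('o, 'm) category \<Rightarrow> ('o list, 'm list) category" where
  "pow_cat n C = \<lparr>Obj = {K. length K = n \<and> set K \<subseteq> Obj C},
     Hom = (\<lambda>K L. {fs. length fs = n \<and> (\<forall>i<n. fs ! i \<in> Hom C (K ! i) (L ! i))}),
     Ident = map (Ident C),
     Comp = (\<lambda>J K L gs fs.
       map (\<lambda>i. Comp C (J ! i) (K ! i) (L ! i) (gs ! i) (fs ! i)) [0..<n])\<rparr>"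

text \<open>Functors to sets. The map \<open>act X a b f\<close> induced by \<open>f : a \<rightarrow> b\<close> is a total HOL function,
  of which only the restriction to \<open>car X a\<close> is meaningful.\<close>

record ('o, 'm, 'a) set_functor =
  car :: "'o \<Rightarrow> 'a set"
  act :: "'o \<Rightarrow> 'o \<Rightarrow> 'm \<Rightarrow> 'a \<Rightarrow> 'a"

record ('o, 'm, 'a) pset_functor = "('o, 'm, 'a) set_functor" +
  pt :: "'o \<Rightarrow> 'a"

definition is_pset_functor :: "('o, 'm) category \<Rightarrow> ('o, 'm, 'a) pset_functor \<Rightarrow> bool" where
  "is_pset_functor C X \<longleftrightarrow>
     (\<forall>a\<in>Obj C. pt X a \<in> car X a) \<and>
     (\<forall>a\<in>Obj C. \<forall>b\<in>Obj C. \<forall>f\<in>Hom C a b.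
        act X a b f \<in> car X a \<rightarrow> car X b \<and> act X a b f (pt X a) = pt X b) \<and>
     (\<forall>a\<in>Obj C. \<forall>x\<in>car X a. act X a a (Ident C a) x = x) \<and>
     (\<forall>a\<in>Obj C. \<forall>b\<in>Obj C. \<forall>c\<in>Obj C. \<forall>f\<in>Hom C a b. \<forall>g\<in>Hom C b c. \<forall>x\<in>car X a.
        act X a c (Comp C a b c g f) x = act X b c g (act X a b f x))"

definition is_pset_nat_trans ::
    "('o, 'm) category \<Rightarrow> ('o, 'm, 'a) pset_functor \<Rightarrow> ('o, 'm, 'b) pset_functor
       \<Rightarrow> ('o \<Rightarrow> 'a \<Rightarrow> 'b) \<Rightarrow> bool" where
  "is_pset_nat_trans C X Y \<eta> \<longleftrightarrow>
     (\<forall>a\<in>Obj C. \<eta> a \<in> car X a \<rightarrow> car Y a \<and> \<eta> a (pt X a) = pt Y a) \<and>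
     (\<forall>a\<in>Obj C. \<forall>b\<in>Obj C. \<forall>f\<in>Hom C a b. \<forall>x\<in>car X a.
        \<eta> b (act X a b f x) = act Y a b f (\<eta> a x))"

definition is_pset_nat_iso ::
    "('o, 'm) category \<Rightarrow> ('o, 'm, 'a) pset_functor \<Rightarrow> ('o, 'm, 'b) pset_functor
       \<Rightarrow> ('o \<Rightarrow> 'a \<Rightarrow> 'b) \<Rightarrow> bool" where
  "is_pset_nat_iso C X Y \<eta> \<longleftrightarrow>
     is_pset_nat_trans C X Y \<eta> \<and> (\<forall>a\<in>Obj C. bij_betw (\<eta> a) (car X a) (car Y a))"

definition representable :: "('o, 'm) category \<Rightarrow> 'o \<Rightarrow> ('o, 'm, 'm) set_functor" where
  "representable C c = \<lparr>car = Hom C c, act = (\<lambda>a b g f. Comp C c a b g f)\<rparr>"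

text \<open>The subfunctor of \<open>X\<close> generated by a family \<open>G\<close> of elements.\<close>

inductive generated ::
    "('o, 'm) category \<Rightarrow> ('o, 'm, 'a) set_functor \<Rightarrow> ('o \<Rightarrow> 'a set) \<Rightarrow> 'o \<Rightarrow> 'a \<Rightarrow> bool"
  for C X G where
  base: "a \<in> Obj C \<Longrightarrow> x \<in> G a \<Longrightarrow> generated C X G a x"
| step: "generated C X G a x \<Longrightarrow> b \<in> Obj C \<Longrightarrow> f \<in> Hom C a b
           \<Longrightarrow> generated C X G b (act X a b f x)"

text \<open>The quotient \<open>A / B\<close>, pointed by the image of \<open>B\<close>, is \<open>A\<close> with \<open>B\<close> collapsed to the point
  \<open>None\<close>. The point is present also for empty \<open>B\<close>.\<close>

definition quot :: "'a set \<Rightarrow> 'a set \<Rightarrow> 'a option set" where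
  "quot A B = insert None (Some ` (A - B))"

definition quot_proj :: "'a set \<Rightarrow> 'a \<Rightarrow> 'a option" where
  "quot_proj B x = (if x \<in> B then None else Some x)"

definition quot_map :: "'b set \<Rightarrow> ('a \<Rightarrow> 'b) \<Rightarrow> 'a option \<Rightarrow> 'b option" where
  "quot_map B' f z = (case z of None \<Rightarrow> None | Some x \<Rightarrow> quot_proj B' (f x))"

definition quot_functor ::
    "('o, 'm, 'a) set_functor \<Rightarrow> ('o \<Rightarrow> 'a set) \<Rightarrow> ('o, 'm, 'a option) pset_functor" where
  "quot_functor X B = \<lparr>car = (\<lambda>a. quot (car X a) (B a)),
     act = (\<lambda>a b f. quot_map (B b) (act X a b f)), pt = (\<lambda>a. None)\<rparr>"


section \<open>The categories of finite pointed sets and of simplices\<close>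

text \<open>The object \<open>\<langle>n\<rangle>\<close> is \<open>n\<close>, with underlying set \<open>{0..n}\<close> and basepoint \<open>0\<close>.\<close>

definition Fin_pt :: "(nat, nat \<Rightarrow> nat) category" where
  "Fin_pt = \<lparr>Obj = UNIV, Hom = (\<lambda>m n. {\<phi> \<in> {0..m} \<rightarrow>\<^sub>E {0..n}. \<phi> 0 = 0}),
     Ident = (\<lambda>m. restrict id {0..m}), Comp = (\<lambda>k m n g f. compose {0..k} g f)\<rparr>"

definition Delta :: "(nat, nat \<Rightarrow> nat) category" where
  "Delta = \<lparr>Obj = UNIV, Hom = (\<lambda>m n. {\<alpha> \<in> {0..m} \<rightarrow>\<^sub>E {0..n}. mono_on {0..m} \<alpha>}),
     Ident = (\<lambda>m. restrict id {0..m}), Comp = (\<lambda>k m n g f. compose {0..k} g f)\<rparr>"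

abbreviation multi_Delta_op :: "nat \<Rightarrow> (nat list, (nat \<Rightarrow> nat) list) category" where
  "multi_Delta_op n \<equiv> pow_cat n (op_cat Delta)"

text \<open>The smash product of maps \<open>f : \<langle>a\<rangle> \<rightarrow> \<langle>a'\<rangle>\<close> and \<open>g : \<langle>b\<rangle> \<rightarrow> \<langle>b'\<rangle>\<close>, with \<open>\<langle>a\<rangle> \<and> \<langle>b\<rangle> = \<langle>a b\<rangle>\<close> by
  lexicographic ordering: \<open>(i, j)\<close> with \<open>1 \<le> i \<le> a\<close>, \<open>1 \<le> j \<le> b\<close> is numbered \<open>(i - 1) b + j\<close>.\<close>

definition smash_pair :: "nat \<Rightarrow> nat \<Rightarrow> nat \<Rightarrow> nat" where
  "smash_pair b i j = (if i = 0 \<or> j = 0 then 0 else (i - 1) * b + j)"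

definition smash_map ::
    "nat \<Rightarrow> nat \<Rightarrow> nat \<Rightarrow> (nat \<Rightarrow> nat) \<Rightarrow> (nat \<Rightarrow> nat) \<Rightarrow> nat \<Rightarrow> nat" where
  "smash_map a b b' f g = (\<lambda>x\<in>{0..a * b}.
     if x = 0 then 0
     else smash_pair b' (f ((x - 1) div b + 1)) (g ((x - 1) mod b + 1)))"

text \<open>The pointed simplicial set \<open>\<Delta>\<^sup>1 / \<partial>\<Delta>\<^sup>1\<close>: in degree \<open>n\<close> its non-basepoint elements are the
  nonconstant monotone maps \<open>[n] \<rightarrow> [1]\<close>. They are numbered by \<open>1, \<dots>, n\<close>, the map numbered \<open>i\<close>
  being \<open>cut_map n i\<close>, which takes the value \<open>1\<close> exactly on \<open>{i..n}\<close>; both constant maps are numbered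
  \<open>0\<close>. The functor \<open>s\<close> is obtained by transport along this numbering.\<close>

definition cut_map :: "nat \<Rightarrow> nat \<Rightarrow> nat \<Rightarrow> nat" where
  "cut_map n i = (\<lambda>j\<in>{0..n}. if i \<le> j then 1 else 0)"

definition cut_index :: "nat \<Rightarrow> (nat \<Rightarrow> nat) \<Rightarrow> nat" where
  "cut_index n f = (if \<forall>j\<in>{0..n}. f j = f 0 then 0 else (LEAST j. f j = 1))"

text \<open>The map \<open>s[k] = \<langle>k\<rangle> \<rightarrow> \<langle>l\<rangle> = s[l]\<close> induced by \<open>\<alpha> : [l] \<rightarrow> [k]\<close>.\<close>

definition s_map :: "nat \<Rightarrow> nat \<Rightarrow> (nat \<Rightarrow> nat) \<Rightarrow> nat \<Rightarrow> nat" where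
  "s_map k l \<alpha> = (\<lambda>i\<in>{0..k}. cut_index l (compose {0..l} (cut_map k i) \<alpha>))"


section \<open>Multisimplicial \<open>\<bbbF>\<^sub>1\<close>-modules and delooping\<close>

text \<open>A \<open>\<Gamma>\<close>-object in \<open>n\<close>-fold simplicial pointed sets, equivalently an \<open>n\<close>-fold simplicial
  \<open>\<bbbF>\<^sub>1\<close>-module, as a functor of two variables.\<close>

type_synonym 'a gamma = "(nat list \<times> nat, (nat \<Rightarrow> nat) list \<times> (nat \<Rightarrow> nat), 'a) pset_functor"

definition gamma_object :: "nat \<Rightarrow> 'a gamma \<Rightarrow> bool" where
  "gamma_object n X \<longleftrightarrow>
     is_pset_functor (prod_cat (multi_Delta_op n) Fin_pt) X \<and>
     (\<forall>K\<in>Obj (multi_Delta_op n). car X (K, 0) = {pt X (K, 0)})"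

text \<open>The two objects may have different element types.\<close>

definition gamma_isomorphic :: "nat \<Rightarrow> 'a gamma \<Rightarrow> 'b gamma \<Rightarrow> bool" where
  "gamma_isomorphic n X Y \<longleftrightarrow> gamma_object n X \<and> gamma_object n Y \<and>
     (\<exists>\<eta>. is_pset_nat_iso (prod_cat (multi_Delta_op n) Fin_pt) X Y \<eta>)"

definition F1 :: "nat gamma" where
  "F1 = \<lparr>car = (\<lambda>(K, m). {0..m}), act = (\<lambda>(K, m) (L, l) (\<alpha>s, \<phi>). \<phi>), pt = (\<lambda>(K, m). 0)\<rparr>"

text \<open>The new simplicial variable is the last one.\<close>

definition deloop :: "'a gamma \<Rightarrow> 'a gamma" where
  "deloop X = \<lparr>car = (\<lambda>(K, m). car X (butlast K, last K * m)),
     act = (\<lambda>(K, m) (L, l) (\<alpha>s, \<phi>).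
       act X (butlast K, last K * m) (butlast L, last L * l)
         (butlast \<alpha>s, smash_map (last K) m l (s_map (last K) (last L) (last \<alpha>s)) \<phi>)),
     pt = (\<lambda>(K, m). pt X (butlast K, last K * m))\<rparr>"


section \<open>The multisimplicial sphere\<close>

definition cube :: "nat \<Rightarrow> (nat list, (nat \<Rightarrow> nat) list, (nat \<Rightarrow> nat) list) set_functor" where
  "cube n = representable (multi_Delta_op n) (replicate n 1)"

text \<open>The face map \<open>[0] \<rightarrow> [1]\<close> omitting \<open>j\<close>.\<close>

definition coface :: "nat \<Rightarrow> nat \<Rightarrow> nat" where
  "coface j = (\<lambda>x\<in>{0..0}. 1 - j)"

definition cube_faces :: "nat \<Rightarrow> nat list \<Rightarrow> (nat \<Rightarrow> nat) list set" where
  "cube_faces n K = {y. \<exists>i<n. \<exists>j\<in>{0, 1}. K = (replicate n 1)[i := 0] \<and>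
     y = act (cube n) (replicate n 1) K ((Ident (multi_Delta_op n) (replicate n 1))[i := coface j])
           (Ident (multi_Delta_op n) (replicate n 1))}"

definition cube_boundary :: "nat \<Rightarrow> nat list \<Rightarrow> (nat \<Rightarrow> nat) list set" where
  "cube_boundary n K = {x. generated (multi_Delta_op n) (cube n) (cube_faces n) K x}"

definition sphere ::
    "nat \<Rightarrow> (nat list, (nat \<Rightarrow> nat) list, (nat \<Rightarrow> nat) list option) pset_functor" where
  "sphere n = quot_functor (cube n) (cube_boundary n)"


section \<open>The \<open>\<Gamma>\<close>-object of a pointed object\<close>

text \<open>The wedge \<open>\<Or>\<^sub>k X\<close> is the objectwise quotient of \<open>{1..k} \<times> X\<close> by \<open>{1..k} \<times> {*}\<close>.\<close>

definition wedge_in :: "nat \<Rightarrow> 'a \<Rightarrow> nat \<Rightarrow> 'a \<Rightarrow> (nat \<times> 'a) option" where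
  "wedge_in k p i x = quot_proj ({1..k} \<times> {p}) (i, x)"

definition wedge :: "nat \<Rightarrow> ('o, 'm, 'a) pset_functor \<Rightarrow> ('o, 'm, (nat \<times> 'a) option) pset_functor"
  where
  "wedge k X = quot_functor
     \<lparr>car = (\<lambda>a. {1..k} \<times> car X a), act = (\<lambda>a b f (i, x). (i, act X a b f x))\<rparr>
     (\<lambda>a. {1..k} \<times> {pt X a})"

definition wedge_map :: "nat \<Rightarrow> 'a \<Rightarrow> (nat \<Rightarrow> nat) \<Rightarrow> (nat \<times> 'a) option \<Rightarrow> (nat \<times> 'a) option" where
  "wedge_map l p \<phi> z =
     (case z of None \<Rightarrow> None | Some (i, x) \<Rightarrow> if \<phi> i = 0 then None else wedge_in l p (\<phi> i) x)"

definition vee ::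
    "('o, 'm, 'a) pset_functor
       \<Rightarrow> ('o \<times> nat, 'm \<times> (nat \<Rightarrow> nat), (nat \<times> 'a) option) pset_functor" where
  "vee X = \<lparr>car = (\<lambda>(a, k). car (wedge k X) a),
     act = (\<lambda>(a, k) (b, l) (f, \<phi>) z. wedge_map l (pt X b) \<phi> (act (wedge k X) a b f z)),
     pt = (\<lambda>(a, k). pt (wedge k X) a)\<rparr>"


section \<open>Consistency of the definitions\<close>

lemma compose_extensional_assoc:
  "f \<in> A \<rightarrow> B \<Longrightarrow> compose A h (compose A g f) = compose A (compose B h g) f"
  by (auto simp: compose_def restrict_def fun_eq_iff Pi_iff)

lemma is_category_Fin_pt: "is_category Fin_pt"
  unfolding is_category_def
proof (intro conjI ballI)
  fix k m f assume "f \<in> Hom Fin_pt k m"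
  then have "f \<in> {0..k} \<rightarrow>\<^sub>E {0..m}" by (simp add: Fin_pt_def)
  then show "Comp Fin_pt k k m f (Ident Fin_pt k) = f" "Comp Fin_pt k m m (Ident Fin_pt m) f = f"
    by (auto simp: Fin_pt_def compose_def restrict_def PiE_iff extensional_def)
next
  fix k m n p f g h assume "f \<in> Hom Fin_pt k m"
  then have "f \<in> {0..k} \<rightarrow> {0..m}" by (auto simp: Fin_pt_def)
  then show "Comp Fin_pt k n p h (Comp Fin_pt k m n g f)
      = Comp Fin_pt k m p (Comp Fin_pt m n p h g) f"
    by (simp add: Fin_pt_def compose_extensional_assoc)
next
  fix k m n f g assume "f \<in> Hom Fin_pt k m" "g \<in> Hom Fin_pt m n"
  then show "Comp Fin_pt k m n g f \<in> Hom Fin_pt k n"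
    by (auto simp: Fin_pt_def PiE_iff compose_def)
qed (auto simp: Fin_pt_def)

lemma is_category_Delta: "is_category Delta"
  unfolding is_category_def
proof (intro conjI ballI)
  fix k m f assume "f \<in> Hom Delta k m"
  then have "f \<in> {0..k} \<rightarrow>\<^sub>E {0..m}" by (simp add: Delta_def)
  then show "Comp Delta k k m f (Ident Delta k) = f" "Comp Delta k m m (Ident Delta m) f = f"
    by (auto simp: Delta_def compose_def restrict_def PiE_iff extensional_def)
next
  fix k m n p f g h assume "f \<in> Hom Delta k m"
  then have "f \<in> {0..k} \<rightarrow> {0..m}" by (auto simp: Delta_def)
  then show "Comp Delta k n p h (Comp Delta k m n g f) = Comp Delta k m p (Comp Delta m n p h g) f"
    by (simp add: Delta_def compose_extensional_assoc)
next
  fix k m n f g assume "f \<in> Hom Delta k m" "g \<in> Hom Delta m n"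
  then show "Comp Delta k m n g f \<in> Hom Delta k n"
    by (auto simp: Delta_def PiE_iff compose_def mono_on_def)
qed (auto simp: Delta_def mono_on_def)

lemma is_category_op: "is_category C \<Longrightarrow> is_category (op_cat C)"
  by (auto simp: is_category_def op_cat_def)

lemma is_category_prod: "is_category C \<Longrightarrow> is_category D \<Longrightarrow> is_category (prod_cat C D)"
  by (auto simp: is_category_def prod_cat_def)

lemma is_category_pow:
  assumes "is_category C" shows "is_category (pow_cat n C)"
proof -
  have *: "K ! i \<in> Obj C" if "K \<in> Obj (pow_cat n C)" "i < n" for K i
    using that by (auto simp: pow_cat_def)
  show ?thesis
    unfolding is_category_def
  proof (intro conjI ballI)
    fix K assume "K \<in> Obj (pow_cat n C)"
    then show "Ident (pow_cat n C) K \<in> Hom (pow_cat n C) K K"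
      using assms * by (auto simp: is_category_def pow_cat_def)
  next
    fix J K L f g assume "J \<in> Obj (pow_cat n C)" "K \<in> Obj (pow_cat n C)" "L \<in> Obj (pow_cat n C)"
      "f \<in> Hom (pow_cat n C) J K" "g \<in> Hom (pow_cat n C) K L"
    then show "Comp (pow_cat n C) J K L g f \<in> Hom (pow_cat n C) J L"
      using assms *[of J] *[of K] *[of L] by (auto simp: is_category_def pow_cat_def)
  next
    fix J K f assume "J \<in> Obj (pow_cat n C)" "K \<in> Obj (pow_cat n C)" "f \<in> Hom (pow_cat n C) J K"
    then show "Comp (pow_cat n C) J J K f (Ident (pow_cat n C) J) = f"
      "Comp (pow_cat n C) J K K (Ident (pow_cat n C) K) f = f"
      using assms *[of J] *[of K]
      by (auto simp: is_category_def pow_cat_def intro!: nth_equalityI)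
  next
    fix J K L M f g h
    assume "J \<in> Obj (pow_cat n C)" "K \<in> Obj (pow_cat n C)" "L \<in> Obj (pow_cat n C)"
      "M \<in> Obj (pow_cat n C)" "f \<in> Hom (pow_cat n C) J K" "g \<in> Hom (pow_cat n C) K L"
      "h \<in> Hom (pow_cat n C) L M"
    then show "Comp (pow_cat n C) J L M h (Comp (pow_cat n C) J K L g f) =
        Comp (pow_cat n C) J K M (Comp (pow_cat n C) K L M h g) f"
      using assms *[of J] *[of K] *[of L] *[of M] by (auto simp: is_category_def pow_cat_def)
  qed
qed

lemma cut_index_cut_map: "i \<le> n \<Longrightarrow> cut_index n (cut_map n i) = i"
proof -
  assume "i \<le> n"
  have "(LEAST j. cut_map n i j = 1) = i" if "0 < i"
  proof (rule Least_equality)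
    show "cut_map n i i = 1" using \<open>i \<le> n\<close> by (simp add: cut_map_def)
    show "i \<le> j" if "cut_map n i j = 1" for j
      using that \<open>i \<le> n\<close> by (cases "j \<le> n") (auto simp: cut_map_def split: if_splits)
  qed
  with \<open>i \<le> n\<close> show ?thesis
    by (cases "i = 0") (auto simp: cut_index_def cut_map_def)
qed

lemma cut_map_cut_index:
  assumes f: "f \<in> Hom Delta n 1" and nonconst: "\<not> (\<forall>j\<in>{0..n}. f j = f 0)"
  shows "cut_index n f \<in> {1..n}" "cut_map n (cut_index n f) = f"
proof -
  have f01: "f j = 0 \<or> f j = 1" if "j \<le> n" for j
  proof -
    have "f j \<in> {0..1}" using f that by (auto simp: Delta_def PiE_iff)
    then show ?thesis by auto
  qed
  have mono: "f i \<le> f j" if "i \<le> j" "j \<le> n" for i j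
    using f that by (auto simp: Delta_def mono_on_def)
  obtain j where j: "j \<le> n" "f j \<noteq> f 0" using nonconst by auto
  have f0: "f 0 = 0" and fj: "f j = 1"
    using f01[of 0] f01[of j] mono[of 0 j] j by auto
  define i where "i = (LEAST j. f j = 1)"
  have i: "f i = 1" "i \<le> j"
    unfolding i_def by (rule LeastI[of "\<lambda>j. f j = 1", OF fj], rule Least_le[of "\<lambda>j. f j = 1", OF fj])
  have ind: "cut_index n f = i" unfolding cut_index_def i_def by (rule if_not_P[OF nonconst])
  have "i \<noteq> 0" using i f0 by (intro notI) simp
  then show "cut_index n f \<in> {1..n}" using i j ind by auto
  show "cut_map n (cut_index n f) = f"
  proof
    fix x
    show "cut_map n (cut_index n f) x = f x"
    proof (cases "x \<le> n")
      case True
      have "f x = 1" if "i \<le> x" using mono[OF that True] i f01[OF True] by auto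
      moreover have "f x = 0" if "x < i"
        using not_less_Least[of x "\<lambda>j. f j = 1"] that f01[OF True] unfolding i_def by auto
      ultimately show ?thesis using True ind by (auto simp: cut_map_def)
    next
      case False
      then show ?thesis using f by (auto simp: cut_map_def Delta_def PiE_iff extensional_def)
    qed
  qed
qed

lemma s_map_functor:
  shows "\<alpha> \<in> Hom Delta l k \<Longrightarrow> s_map k l \<alpha> \<in> Hom Fin_pt k l"
    and "s_map k k (Ident Delta k) = Ident Fin_pt k"
    and "\<alpha> \<in> Hom Delta l k \<Longrightarrow> \<beta> \<in> Hom Delta m l \<Longrightarrow>
           s_map k m (Comp Delta m l k \<alpha> \<beta>) = Comp Fin_pt k l m (s_map l m \<beta>) (s_map k l \<alpha>)"
proof -
  have comp: "compose {0..l} (cut_map k i) \<alpha> \<in> Hom Delta l 1"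
    if "\<alpha> \<in> Hom Delta l k" for k l i \<alpha>
  proof -
    have le: "\<alpha> r \<le> k" if "r \<le> l" for r
      using \<open>\<alpha> \<in> Hom Delta l k\<close> that by (auto simp: Delta_def PiE_iff)
    have mono: "i \<le> \<alpha> s" if "i \<le> \<alpha> r" "r \<le> s" "s \<le> l" for r s
      using \<open>\<alpha> \<in> Hom Delta l k\<close> that by (fastforce simp: Delta_def mono_on_def)
    have "mono_on {0..l} (compose {0..l} (cut_map k i) \<alpha>)"
    proof (rule mono_onI)
      fix r s assume "r \<in> {0..l}" "s \<in> {0..l}" "r \<le> s"
      then show "compose {0..l} (cut_map k i) \<alpha> r \<le> compose {0..l} (cut_map k i) \<alpha> s"
        using mono[of r s] le[of r] le[of s] by (simp add: compose_def cut_map_def)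
    qed
    then show ?thesis
      by (auto simp: Delta_def compose_def cut_map_def le)
  qed
  have const: "cut_index l f = 0" if "\<forall>j\<in>{0..l}. f j = f 0" for l f
    unfolding cut_index_def by (rule if_P[OF that])
  have s0: "s_map k l \<alpha> 0 = 0" if "\<alpha> \<in> Hom Delta l k" for k l \<alpha>
  proof -
    have "\<alpha> j \<le> k" if "j \<le> l" for j
      using \<open>\<alpha> \<in> Hom Delta l k\<close> that by (auto simp: Delta_def PiE_iff)
    then have "cut_index l (compose {0..l} (cut_map k 0) \<alpha>) = 0"
      by (intro const ballI) (simp add: compose_def cut_map_def)
    then show ?thesis by (simp add: s_map_def)
  qed
  have sle: "cut_index l f \<le> l" if "f \<in> Hom Delta l 1" for l f
  proof (cases "\<forall>j\<in>{0..l}. f j = f 0")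
    case False
    from cut_map_cut_index(1)[OF that False] show ?thesis by simp
  qed (simp only: const le0)
  show "s_map k l \<alpha> \<in> Hom Fin_pt k l" if "\<alpha> \<in> Hom Delta l k"
    using s0[OF that] sle[OF comp[OF that]] by (auto simp: Fin_pt_def s_map_def)
  have "compose {0..k} (cut_map k i) (restrict id {0..k}) = cut_map k i" for i
    by (auto simp: compose_def cut_map_def)
  then show "s_map k k (Ident Delta k) = Ident Fin_pt k"
    by (auto simp: s_map_def Delta_def Fin_pt_def cut_index_cut_map)
  assume \<alpha>: "\<alpha> \<in> Hom Delta l k" and \<beta>: "\<beta> \<in> Hom Delta m l"
  then have Pi: "\<beta> \<in> {0..m} \<rightarrow> {0..l}" by (auto simp: Delta_def)
  have "cut_index m (compose {0..m} f \<beta>) = s_map l m \<beta> (cut_index l f)"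
    if f: "f \<in> Hom Delta l 1" for f
  proof (cases "\<forall>j\<in>{0..l}. f j = f 0")
    case True
    have "compose {0..m} f \<beta> j = f 0" if "j \<in> {0..m}" for j
      using that bspec[OF True, of "\<beta> j"] funcset_mem[OF Pi that] by (simp add: compose_def)
    then have "cut_index m (compose {0..m} f \<beta>) = 0"
      by (intro const ballI) (metis atLeastAtMost_iff le0)
    then show ?thesis by (simp only: const[OF True] s0[OF \<beta>])
  next
    case False
    from cut_map_cut_index[OF f False] show ?thesis by (simp add: s_map_def)
  qed
  from this[OF comp[OF \<alpha>]]
  show "s_map k m (Comp Delta m l k \<alpha> \<beta>) = Comp Fin_pt k l m (s_map l m \<beta>) (s_map k l \<alpha>)"
    by (simp add: s_map_def[of k] Delta_def Fin_pt_def compose_def[of "{0..k}"]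
        compose_extensional_assoc[OF Pi, symmetric] cong: restrict_cong)
qed

lemma bij_smash_pair:
  "bij_betw (\<lambda>(i, j). smash_pair b i j) ({1..a} \<times> {1..b}) {1..a * b}"
proof (rule bij_betw_byWitness[where f' = "\<lambda>x. ((x - 1) div b + 1, (x - 1) mod b + 1)"])
  show "\<forall>p\<in>{1..a} \<times> {1..b}. (\<lambda>x. ((x - 1) div b + 1, (x - 1) mod b + 1))
      ((\<lambda>(i, j). smash_pair b i j) p) = p"
  proof
    fix p assume "p \<in> {1..a} \<times> {1..b}"
    then obtain i j where p: "p = (Suc i, Suc j)" "i < a" "j < b"
      by (cases p; cases "fst p"; cases "snd p") auto
    then show "(\<lambda>x. ((x - 1) div b + 1, (x - 1) mod b + 1)) ((\<lambda>(i, j). smash_pair b i j) p) = p"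
      by (simp add: smash_pair_def)
  qed
  show "\<forall>x\<in>{1..a * b}. (\<lambda>(i, j). smash_pair b i j) ((x - 1) div b + 1, (x - 1) mod b + 1) = x"
    by (auto simp: smash_pair_def)
  show "(\<lambda>(i, j). smash_pair b i j) ` ({1..a} \<times> {1..b}) \<subseteq> {1..a * b}"
  proof clarify
    fix i j assume "i \<in> {1..a}" "j \<in> {1..b}"
    then obtain i' where i: "i = Suc i'" "Suc i' \<le> a" "1 \<le> j" "j \<le> b" by (cases i) auto
    from i(2) have "Suc i' * b \<le> a * b" by (rule mult_le_mono1)
    with i show "smash_pair b i j \<in> {1..a * b}" by (auto simp: smash_pair_def)
  qed
  show "(\<lambda>x. ((x - 1) div b + 1, (x - 1) mod b + 1)) ` {1..a * b} \<subseteq> {1..a} \<times> {1..b}"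
  proof
    fix p assume "p \<in> (\<lambda>x. ((x - 1) div b + 1, (x - 1) mod b + 1)) ` {1..a * b}"
    then obtain y where y: "y \<in> {1..a * b}" "p = ((y - 1) div b + 1, (y - 1) mod b + 1)"
      by blast
    define x where "x = y - 1"
    have x: "x < a * b" "p = (x div b + 1, x mod b + 1)"
      using y by (auto simp: x_def)
    then have "b > 0" by (cases b) auto
    then show "p \<in> {1..a} \<times> {1..b}"
      using x by (auto simp: Suc_le_eq less_mult_imp_div_less)
  qed
qed

lemma smash_map_smash_pair:
  assumes "i \<le> a" "j \<le> b" "f 0 = 0" "g 0 = 0"
  shows "smash_map a b b' f g (smash_pair b i j) = smash_pair b' (f i) (g j)"
proof (cases "i = 0 \<or> j = 0")
  case True
  then show ?thesis using assms by (auto simp: smash_map_def smash_pair_def)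
next
  case False
  then obtain i' j' where ij: "i = Suc i'" "j = Suc j'" by (metis not0_implies_Suc)
  have "smash_pair b i j \<in> {1..a * b}"
    using bij_betw_apply[OF bij_smash_pair[of b a], of "(i, j)"] False assms by simp
  then show ?thesis using assms ij by (auto simp: smash_map_def smash_pair_def)
qed

text \<open>The functor \<open>wedge k X\<close> is the coproduct of \<open>k\<close> copies of \<open>X\<close> in the category of functors to
  pointed sets.\<close>

lemma wedge_coproduct:
  assumes X: "is_pset_functor C X" and Y: "is_pset_functor C Y"
    and h: "\<And>i. i \<in> {1..k} \<Longrightarrow> is_pset_nat_trans C X Y (h i)"
  shows "is_pset_functor C (wedge k X)"
    and "\<And>i. i \<in> {1..k} \<Longrightarrow>
           is_pset_nat_trans C X (wedge k X) (\<lambda>a. wedge_in k (pt X a) i)"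
    and "\<exists>g. is_pset_nat_trans C (wedge k X) Y g \<and>
           (\<forall>i\<in>{1..k}. \<forall>a\<in>Obj C. \<forall>x\<in>car X a. g a (wedge_in k (pt X a) i x) = h i a x)"
    and "\<And>g g' a z. is_pset_nat_trans C (wedge k X) Y g \<Longrightarrow> is_pset_nat_trans C (wedge k X) Y g' \<Longrightarrow>
           \<forall>i\<in>{1..k}. \<forall>a\<in>Obj C. \<forall>x\<in>car X a.
             g a (wedge_in k (pt X a) i x) = g' a (wedge_in k (pt X a) i x) \<Longrightarrow>
           a \<in> Obj C \<Longrightarrow> z \<in> car (wedge k X) a \<Longrightarrow> g a z = g' a z"
proof -
  note defs = wedge_def quot_functor_def quot_def quot_map_def quot_proj_def wedge_in_def
  have Xpt: "pt X a \<in> car X a" if "a \<in> Obj C" for a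
    using X that by (simp add: is_pset_functor_def)
  have Xact: "x \<in> car X a \<Longrightarrow> act X a b f x \<in> car X b" "act X a b f (pt X a) = pt X b"
    if "a \<in> Obj C" "b \<in> Obj C" "f \<in> Hom C a b" for a b f x
    using X that by (auto simp: is_pset_functor_def Pi_iff)
  have Xid: "act X a a (Ident C a) x = x" if "a \<in> Obj C" "x \<in> car X a" for a x
    using X that by (simp add: is_pset_functor_def)
  have Xcomp: "act X a c (Comp C a b c g f) x = act X b c g (act X a b f x)"
    if "a \<in> Obj C" "b \<in> Obj C" "c \<in> Obj C" "f \<in> Hom C a b" "g \<in> Hom C b c" "x \<in> car X a"
    for a b c f g x
    using X that by (simp add: is_pset_functor_def)
  have elem: "z = None \<or> (\<exists>i x. i \<in> {1..k} \<and> x \<in> car X a \<and> x \<noteq> pt X a \<and> z = Some (i, x))"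
    if "z \<in> car (wedge k X) a" for a z
    using that by (auto simp: defs)
  have car: "Some (i, x) \<in> car (wedge k X) a \<longleftrightarrow> i \<in> {1..k} \<and> x \<in> car X a \<and> x \<noteq> pt X a"
    "None \<in> car (wedge k X) a" for a i x
    by (auto simp: defs)
  have ptw: "pt (wedge k X) a = None" for a
    by (simp add: defs)
  have act: "act (wedge k X) a b f None = None"
    "act (wedge k X) a b f (Some (i, x)) = wedge_in k (pt X b) i (act X a b f x)" for a b f i x
    by (simp_all add: defs)
  have win: "wedge_in k p i x = (if i \<in> {1..k} \<and> x = p then None else Some (i, x))" for p i x
    by (auto simp: defs)
  show "is_pset_functor C (wedge k X)"
    unfolding is_pset_functor_def
  proof (intro conjI ballI funcsetI)
    fix a b f z assume "a \<in> Obj C" "b \<in> Obj C" "f \<in> Hom C a b" "z \<in> car (wedge k X) a"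
    then show "act (wedge k X) a b f z \<in> car (wedge k X) b"
      using elem[of z a] by (auto simp: act win car Xact)
  next
    fix a z assume "a \<in> Obj C" "z \<in> car (wedge k X) a"
    then show "act (wedge k X) a a (Ident C a) z = z"
      using elem[of z a] by (auto simp: act win Xid)
  next
    fix a b c f g z assume "a \<in> Obj C" "b \<in> Obj C" "c \<in> Obj C" "f \<in> Hom C a b" "g \<in> Hom C b c"
      "z \<in> car (wedge k X) a"
    then show "act (wedge k X) a c (Comp C a b c g f) z =
        act (wedge k X) b c g (act (wedge k X) a b f z)"
      using elem[of z a] by (auto simp: act win Xcomp Xact Xpt)
  qed (simp_all add: ptw car act)
  show "is_pset_nat_trans C X (wedge k X) (\<lambda>a. wedge_in k (pt X a) i)" if "i \<in> {1..k}" for i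
    using that by (auto simp: is_pset_nat_trans_def win ptw car act Xact Xpt)
  let ?g = "\<lambda>a z. case z of None \<Rightarrow> pt Y a | Some (i, x) \<Rightarrow> h i a x"
  have hcar: "h i a x \<in> car Y a" and hpt: "h i a (pt X a) = pt Y a"
    if "i \<in> {1..k}" "a \<in> Obj C" "x \<in> car X a" for i a x
    using h[OF that(1)] that by (auto simp: is_pset_nat_trans_def)
  have hnat: "h i b (act X a b f x) = act Y a b f (h i a x)"
    if "i \<in> {1..k}" "a \<in> Obj C" "b \<in> Obj C" "f \<in> Hom C a b" "x \<in> car X a" for i a b f x
    using h[OF that(1)] that by (auto simp: is_pset_nat_trans_def)
  have Ypt: "pt Y a \<in> car Y a" if "a \<in> Obj C" for a
    using Y that by (simp add: is_pset_functor_def)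
  have Yact: "act Y a b f (pt Y a) = pt Y b" if "a \<in> Obj C" "b \<in> Obj C" "f \<in> Hom C a b" for a b f
    using Y that by (simp add: is_pset_functor_def)
  have "is_pset_nat_trans C (wedge k X) Y ?g"
    unfolding is_pset_nat_trans_def
  proof (intro conjI ballI funcsetI)
    fix a z assume "a \<in> Obj C" "z \<in> car (wedge k X) a"
    then show "?g a z \<in> car Y a"
      using elem[of z a] by (auto simp: Ypt hcar)
  next
    fix a b f z assume *: "a \<in> Obj C" "b \<in> Obj C" "f \<in> Hom C a b" "z \<in> car (wedge k X) a"
    from elem[OF *(4)] show "?g b (act (wedge k X) a b f z) = act Y a b f (?g a z)"
    proof (elim disjE exE conjE)
      fix i x assume i: "i \<in> {1..k}" "x \<in> car X a" "z = Some (i, x)"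
      have "?g b (wedge_in k (pt X b) i (act X a b f x)) = h i b (act X a b f x)"
        using i * hpt[of i b "pt X b"] Xpt by (simp add: win)
      then show ?thesis using i * by (simp add: act hnat)
    qed (use * in \<open>simp add: act Yact\<close>)
  qed (simp add: ptw)
  moreover have "?g a (wedge_in k (pt X a) i x) = h i a x"
    if "i \<in> {1..k}" "a \<in> Obj C" for i a x
    using that hpt[of i a "pt X a"] Xpt by (simp add: win)
  ultimately show "\<exists>g. is_pset_nat_trans C (wedge k X) Y g \<and>
      (\<forall>i\<in>{1..k}. \<forall>a\<in>Obj C. \<forall>x\<in>car X a. g a (wedge_in k (pt X a) i x) = h i a x)"
    by blast
  show "g a z = g' a z"
    if g: "is_pset_nat_trans C (wedge k X) Y g" "is_pset_nat_trans C (wedge k X) Y g'"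
      and eq: "\<forall>i\<in>{1..k}. \<forall>a\<in>Obj C. \<forall>x\<in>car X a.
        g a (wedge_in k (pt X a) i x) = g' a (wedge_in k (pt X a) i x)"
      and a: "a \<in> Obj C" and z: "z \<in> car (wedge k X) a" for g g' a z
  proof (cases z)
    case None
    then show ?thesis using g a by (auto simp: is_pset_nat_trans_def defs)
  next
    case (Some p)
    then obtain i x where "i \<in> {1..k}" "x \<in> car X a" "x \<noteq> pt X a" "z = Some (i, x)"
      using elem[OF z] by auto
    moreover from this have "wedge_in k (pt X a) i x = z" by (auto simp: defs)
    ultimately show ?thesis using eq a by metis
  qed
qed

end

theory Submission
  imports Defs
begin

text \<open>The point is that both sides have the same description in coordinates. Unfolding the deloopings,
  \<open>\<BB>\<^sup>n \<bbbF>\<^sub>1\<close> takes the value \<open>\<langle>k\<^sub>1\<rangle> \<and> \<dots> \<and> \<langle>k\<^sub>n\<rangle> \<and> \<langle>m\<rangle>\<close> at \<open>([k\<^sub>1, \<dots>, k\<^sub>n], \<langle>m\<rangle>)\<close>, and \<open>\<langle>k\<rangle> = s[k]\<close> is the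
  set of monotone maps \<open>[k] \<rightarrow> [1]\<close> with the constant ones collapsed to the basepoint. Hence its
  elements off the basepoint are the tuples \<open>(f\<^sub>1, \<dots>, f\<^sub>n, i)\<close> of nonconstant monotone maps
  \<open>f\<^sub>j : [k\<^sub>j] \<rightarrow> [1]\<close> and some \<open>i \<in> {1..m}\<close>. On the other side, an element of the \<open>n\<close>-cube in multidegree
  \<open>[k\<^sub>1, \<dots>, k\<^sub>n]\<close> is a tuple of monotone maps \<open>f\<^sub>j : [k\<^sub>j] \<rightarrow> [1]\<close>, and it lies on the boundary exactly
  when one of the \<open>f\<^sub>j\<close> is constant, that is, factors through a vertex of \<open>[1]\<close>
  (\<open>cube_boundary_iff\<close>). So the elements of \<open>\<Or>\<^sub>m \<SS>\<^sup>n\<close> off the basepoint are the same tuples.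

  The comparison map goes from the wedge of spheres to the delooping: \<open>lex_number\<close> numbers the tuples
  by iterated lexicographic ordering. It is defined also on tuples with constant \<open>f\<^sub>j\<close> or with
  \<open>i = 0\<close>, where it gives the basepoint; thereby naturality (\<open>act_deloop_lex_number\<close>) is a single
  equation without case distinction, and it reduces to the facts that \<open>s\<close> and the smash product are
  computed on representatives (\<open>cut_index_compose\<close>, \<open>smash_map_smash_pair\<close>). Only the wedge of spheres
  has to be shown to be a \<open>\<Gamma>\<close>-object directly: the functor laws are then transported along the
  comparison bijection (\<open>gamma_isomorphic_by_inverse\<close>).\<close>

section \<open>Monotone maps to the interval\<close>

lemma Comp_Delta: "Comp Delta k l m g f = compose {0..k} g f"
  by (simp add: Delta_def)

lemma cut_index_const: "\<forall>j\<in>{0..n}. f j = f 0 \<Longrightarrow> cut_index n f = 0"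
  unfolding cut_index_def by (rule if_P)

lemma cut_map_Hom: "cut_map k i \<in> Hom Delta k 1"
  by (auto simp: Delta_def cut_map_def mono_on_def)

lemma s_map_0: "\<beta> \<in> Hom Delta m l \<Longrightarrow> s_map l m \<beta> 0 = 0"
  using s_map_functor(1)[of \<beta> m l] by (simp add: Fin_pt_def)

lemma cut_index_le: "f \<in> Hom Delta k 1 \<Longrightarrow> cut_index k f \<le> k"
  by (metis cut_map_cut_index(1) cut_index_const atLeastAtMost_iff le0)

text \<open>The functor \<open>s\<close> is precomposition of monotone maps to \<open>[1]\<close>, read off on the numbering; this
  also holds for the constant maps, which are all numbered \<open>0\<close>.\<close>

lemma cut_index_compose:
  assumes \<beta>: "\<beta> \<in> Hom Delta m l" and f: "f \<in> Hom Delta l 1"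
  shows "cut_index m (compose {0..m} f \<beta>) = s_map l m \<beta> (cut_index l f)"
proof (cases "\<forall>j\<in>{0..l}. f j = f 0")
  case True
  have "f (\<beta> j) = f 0" if "j \<le> m" for j
    using bspec[OF True, of "\<beta> j"] \<beta> that by (auto simp: Delta_def PiE_iff)
  then have "cut_index m (compose {0..m} f \<beta>) = 0"
    by (intro cut_index_const) (simp add: compose_def)
  then show ?thesis by (simp only: cut_index_const[OF True] s_map_0[OF \<beta>])
next
  case False
  from cut_map_cut_index[OF f False] show ?thesis by (simp add: s_map_def)
qed

lemma bij_cut_index: "bij_betw (cut_index k) {f \<in> Hom Delta k 1. cut_index k f \<noteq> 0} {1..k}"
proof (rule bij_betw_byWitness[where f' = "cut_map k"])
  show "\<forall>f\<in>{f \<in> Hom Delta k 1. cut_index k f \<noteq> 0}. cut_map k (cut_index k f) = f"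
  proof clarify
    fix f assume f: "f \<in> Hom Delta k 1" "0 < cut_index k f"
    then have "\<not> (\<forall>j\<in>{0..k}. f j = f 0)" by (metis cut_index_const less_irrefl)
    with f(1) show "cut_map k (cut_index k f) = f" by (rule cut_map_cut_index(2))
  qed
  show "\<forall>i\<in>{1..k}. cut_index k (cut_map k i) = i"
    by (simp add: cut_index_cut_map)
  show "cut_index k ` {f \<in> Hom Delta k 1. cut_index k f \<noteq> 0} \<subseteq> {1..k}"
  proof clarify
    fix f assume "f \<in> Hom Delta k 1" "0 < cut_index k f"
    then show "cut_index k f \<in> {1..k}" using cut_index_le[of f k] by simp
  qed
  show "cut_map k ` {1..k} \<subseteq> {f \<in> Hom Delta k 1. cut_index k f \<noteq> 0}"
  proof (rule image_subsetI, rule CollectI)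
    fix i assume "i \<in> {1..k}"
    then show "cut_map k i \<in> Hom Delta k 1 \<and> cut_index k (cut_map k i) \<noteq> 0"
      using cut_map_Hom[of k i] cut_index_cut_map[of i k] by simp
  qed
qed


section \<open>The cube and its boundary\<close>

lemma is_category_multi_Delta_op: "is_category (multi_Delta_op n)"
  by (intro is_category_pow is_category_op is_category_Delta)

lemma Obj_multi_Delta_op: "K \<in> Obj (multi_Delta_op n) \<longleftrightarrow> length K = n"
  by (simp add: pow_cat_def op_cat_def Delta_def)

lemma Hom_multi_Delta_op:
  "\<alpha>s \<in> Hom (multi_Delta_op n) K L \<longleftrightarrow>
     length \<alpha>s = n \<and> (\<forall>i<n. \<alpha>s ! i \<in> Hom Delta (L ! i) (K ! i))"
  by (simp add: pow_cat_def op_cat_def)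

lemma car_cube:
  "fs \<in> car (cube n) K \<longleftrightarrow> length fs = n \<and> (\<forall>i<n. fs ! i \<in> Hom Delta (K ! i) 1)"
  by (auto simp: cube_def representable_def Hom_multi_Delta_op)

lemma act_cube:
  "act (cube n) K L \<alpha>s fs = map (\<lambda>i. compose {0..L ! i} (fs ! i) (\<alpha>s ! i)) [0..<n]"
  by (simp add: cube_def representable_def pow_cat_def op_cat_def Comp_Delta)

lemma constant_in_cube: "length K = n \<Longrightarrow> map (\<lambda>k. cut_map k 0) K \<in> car (cube n) K"
  using cut_map_Hom by (auto simp: car_cube)

lemma act_cube_car:
  assumes "K \<in> Obj (multi_Delta_op n)" "L \<in> Obj (multi_Delta_op n)"
    "\<alpha>s \<in> Hom (multi_Delta_op n) K L" "fs \<in> car (cube n) K"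
  shows "act (cube n) K L \<alpha>s fs \<in> car (cube n) L"
  using is_category_multi_Delta_op[of n] assms Obj_multi_Delta_op[of "replicate n 1" n]
  unfolding is_category_def cube_def representable_def by simp

lemma generated_Obj: "generated C X G a x \<Longrightarrow> a \<in> Obj C"
  by (induction rule: generated.induct)

lemma generated_cube_faces:
  assumes "generated (multi_Delta_op n) (cube n) (cube_faces n) K x"
  shows "x \<in> car (cube n) K \<and> (\<exists>i<n. cut_index (K ! i) (x ! i) = 0)"
  using assms
proof (induction rule: generated.induct)
  case (base K x)
  then obtain i j where i: "i < n" "j \<in> {0, 1}" "K = (replicate n 1)[i := 0]"
    and x: "x = act (cube n) (replicate n 1) K
      ((Ident (multi_Delta_op n) (replicate n 1))[i := coface j])
      (Ident (multi_Delta_op n) (replicate n 1))"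
    unfolding cube_faces_def by blast
  have 1: "replicate n 1 \<in> Obj (multi_Delta_op n)"
    by (simp add: Obj_multi_Delta_op)
  have id: "Ident (multi_Delta_op n) (replicate n 1)
      \<in> Hom (multi_Delta_op n) (replicate n 1) (replicate n 1)"
    using is_category_multi_Delta_op[of n] 1 unfolding is_category_def by blast
  have "coface j \<in> Hom Delta 0 1"
    by (auto simp: coface_def Delta_def mono_on_def)
  then have "(Ident (multi_Delta_op n) (replicate n 1))[i := coface j]
      \<in> Hom (multi_Delta_op n) (replicate n 1) K"
    using id i by (auto simp: Hom_multi_Delta_op nth_list_update)
  moreover have "Ident (multi_Delta_op n) (replicate n 1) \<in> car (cube n) (replicate n 1)"
    using id by (simp add: cube_def representable_def)
  ultimately have "x \<in> car (cube n) K"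
    unfolding x using act_cube_car[OF 1 \<open>K \<in> Obj (multi_Delta_op n)\<close>] by blast
  moreover have "cut_index (K ! i) (x ! i) = 0"
    using i by (intro cut_index_const) (simp add: Obj_multi_Delta_op)
  ultimately show ?case using i(1) by blast
next
  case (step K x L \<alpha>s)
  then obtain i where i: "i < n" "cut_index (K ! i) (x ! i) = 0" by blast
  have "K \<in> Obj (multi_Delta_op n)"
    using step.hyps(1) by (rule generated_Obj)
  then have "act (cube n) K L \<alpha>s x \<in> car (cube n) L"
    using step act_cube_car by blast
  moreover have "cut_index (L ! i) (act (cube n) K L \<alpha>s x ! i) = 0"
    using step i cut_index_compose[of "\<alpha>s ! i" "L ! i" "K ! i" "x ! i"]
    by (simp add: act_cube Hom_multi_Delta_op car_cube s_map_0 del: One_nat_def)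
  ultimately show ?case using i(1) by blast
qed

text \<open>A map to \<open>[1]\<close> is constant exactly when it factors through a vertex, and then so does every
  precomposite. So constant entries persist in the subfunctor generated by the faces; conversely a
  tuple whose \<open>i\<close>-th entry is constant comes from one of the two faces in direction \<open>i\<close>, by the
  operator with entries \<open>f\<^sub>p\<close> for \<open>p \<noteq> i\<close> and the projection \<open>[k\<^sub>i] \<rightarrow> [0]\<close> in place \<open>i\<close>.\<close>

lemma cube_boundary_iff:
  assumes K: "K \<in> Obj (multi_Delta_op n)" and x: "x \<in> car (cube n) K"
  shows "x \<in> cube_boundary n K \<longleftrightarrow> (\<exists>i<n. cut_index (K ! i) (x ! i) = 0)"
proof
  show "\<exists>i<n. cut_index (K ! i) (x ! i) = 0" if "x \<in> cube_boundary n K"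
    using that generated_cube_faces by (auto simp: cube_boundary_def)
next
  assume "\<exists>i<n. cut_index (K ! i) (x ! i) = 0"
  then obtain i where i: "i < n" "cut_index (K ! i) (x ! i) = 0" by blast
  have xp: "x ! p \<in> {0..K ! p} \<rightarrow>\<^sub>E {0..1}" if "p < n" for p
    using x that by (simp add: car_cube Delta_def)
  have const: "\<forall>r\<in>{0..K ! i}. (x ! i) r = (x ! i) 0"
  proof (rule ccontr)
    assume nonconst: "\<not> ?thesis"
    have "x ! i \<in> Hom Delta (K ! i) 1" using x i(1) by (simp only: car_cube)
    from cut_map_cut_index(1)[OF this nonconst] i(2) show False by simp
  qed
  \<comment> \<open>The coface that omits \<open>j\<close> hits \<open>1 - j\<close>, which has to be the value of \<open>x ! i\<close>.\<close>
  define j where "j = 1 - (x ! i) 0"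
  have "(x ! i) 0 \<le> 1" using xp[OF i(1)] by (auto simp: PiE_iff)
  then have j: "j \<in> {0, 1}" "1 - j = (x ! i) 0" by (auto simp: j_def)
  define J where "J = (replicate n (1::nat))[i := 0]"
  define y where "y = act (cube n) (replicate n 1) J
    ((Ident (multi_Delta_op n) (replicate n 1))[i := coface j])
    (Ident (multi_Delta_op n) (replicate n 1))"
  define \<alpha>s where "\<alpha>s = x[i := (\<lambda>_\<in>{0..K ! i}. 0)]"
  have J: "J \<in> Obj (multi_Delta_op n)" by (simp add: J_def Obj_multi_Delta_op)
  have "y \<in> cube_faces n J"
    unfolding cube_faces_def using i(1) j(1) by (auto simp: y_def J_def)
  then have gen: "generated (multi_Delta_op n) (cube n) (cube_faces n) J y"
    using J by (rule generated.base[rotated])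
  have "(\<lambda>_\<in>{0..K ! i}. 0) \<in> Hom Delta (K ! i) 0"
    by (auto simp: Delta_def mono_on_def)
  then have \<alpha>s: "\<alpha>s \<in> Hom (multi_Delta_op n) J K"
    using x i(1) unfolding Hom_multi_Delta_op \<alpha>s_def J_def car_cube
    by (auto simp: nth_list_update simp del: One_nat_def)
  have "act (cube n) J K \<alpha>s y = x"
  proof (rule nth_equalityI)
    show "length (act (cube n) J K \<alpha>s y) = length x"
      using x by (simp add: act_cube car_cube)
    fix p assume "p < length (act (cube n) J K \<alpha>s y)"
    then have p: "p < n" by (simp add: act_cube)
    have len: "length x = n" using x by (simp add: car_cube)
    have id: "Ident (multi_Delta_op n) (replicate n 1) = replicate n (restrict id {0..1})"
      by (simp add: pow_cat_def op_cat_def Delta_def)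
    show "act (cube n) J K \<alpha>s y ! p = x ! p"
    proof
      fix r
      show "(act (cube n) J K \<alpha>s y ! p) r = (x ! p) r"
      proof (cases "r \<le> K ! p")
        case True
        have "(x ! p) r \<le> 1" using xp[OF p] True by (auto simp: PiE_iff)
        then show ?thesis
          using p i(1) j(2) True bspec[OF const, of r] len unfolding y_def id
          by (cases "p = i") (simp_all add: act_cube \<alpha>s_def J_def compose_def coface_def)
      next
        case False
        then have "(x ! p) r = undefined" using xp[OF p] by (auto simp: PiE_iff extensional_def)
        then show ?thesis using p False by (simp add: act_cube compose_def)
      qed
    qed
  qed
  with generated.step[OF gen K \<alpha>s] show "x \<in> cube_boundary n K"
    by (simp add: cube_boundary_def)
qed


section \<open>The sphere and its wedges are functors\<close>

lemma is_pset_functor_quot: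
  assumes "\<And>a b f x. \<lbrakk>a \<in> Obj C; b \<in> Obj C; f \<in> Hom C a b; x \<in> car X a\<rbrakk> \<Longrightarrow> act X a b f x \<in> car X b"
    and "\<And>a x. \<lbrakk>a \<in> Obj C; x \<in> car X a\<rbrakk> \<Longrightarrow> act X a a (Ident C a) x = x"
    and "\<And>a b c f g x. \<lbrakk>a \<in> Obj C; b \<in> Obj C; c \<in> Obj C; f \<in> Hom C a b; g \<in> Hom C b c; x \<in> car X a\<rbrakk>
           \<Longrightarrow> act X a c (Comp C a b c g f) x = act X b c g (act X a b f x)"
    and "\<And>a b f x. \<lbrakk>a \<in> Obj C; b \<in> Obj C; f \<in> Hom C a b; x \<in> B a\<rbrakk> \<Longrightarrow> act X a b f x \<in> B b"
    and "\<And>a. a \<in> Obj C \<Longrightarrow> B a \<subseteq> car X a"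
  shows "is_pset_functor C (quot_functor X B)"
  unfolding is_pset_functor_def
proof (intro conjI ballI funcsetI)
  fix a b c f g z
  assume *: "a \<in> Obj C" "b \<in> Obj C" "c \<in> Obj C" "f \<in> Hom C a b" "g \<in> Hom C b c"
    "z \<in> car (quot_functor X B) a"
  show "act (quot_functor X B) a c (Comp C a b c g f) z
      = act (quot_functor X B) b c g (act (quot_functor X B) a b f z)"
    using * assms(3)[OF *(1-5)] assms(4)[OF *(2,3,5)]
    by (auto simp: quot_functor_def quot_def quot_map_def quot_proj_def)
next
  fix a b f z assume "a \<in> Obj C" "b \<in> Obj C" "f \<in> Hom C a b" "z \<in> car (quot_functor X B) a"
  then show "act (quot_functor X B) a b f z \<in> car (quot_functor X B) b"
    using assms(1)[of a b f]
    by (cases z; cases "act X a b f (the z) \<in> B b")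
      (auto simp: quot_functor_def quot_def quot_map_def quot_proj_def)
qed (auto simp: quot_functor_def quot_def quot_map_def quot_proj_def assms)

lemma is_pset_functor_sphere: "is_pset_functor (multi_Delta_op n) (sphere n)"
  unfolding sphere_def
proof (rule is_pset_functor_quot)
  let ?D = "multi_Delta_op n"
  have cat: "is_category ?D" by (rule is_category_multi_Delta_op)
  have 1: "replicate n 1 \<in> Obj ?D" by (simp add: Obj_multi_Delta_op)
  show "act (cube n) K K (Ident ?D K) x = x" if "K \<in> Obj ?D" "x \<in> car (cube n) K" for K x
    using cat 1 that unfolding is_category_def cube_def representable_def by simp
  show "act (cube n) J L (Comp ?D J K L g f) x = act (cube n) K L g (act (cube n) J K f x)"
    if "J \<in> Obj ?D" "K \<in> Obj ?D" "L \<in> Obj ?D" "f \<in> Hom ?D J K" "g \<in> Hom ?D K L"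
      "x \<in> car (cube n) J" for J K L f g x
    using cat 1 that unfolding is_category_def cube_def representable_def by simp
  show "act (cube n) K L f x \<in> cube_boundary n L"
    if "L \<in> Obj ?D" "f \<in> Hom ?D K L" "x \<in> cube_boundary n K" for K L f x
    using that by (auto simp: cube_boundary_def intro: generated.step)
  show "cube_boundary n K \<subseteq> car (cube n) K" for K
    using generated_cube_faces by (auto simp: cube_boundary_def)
qed (rule act_cube_car)

lemma vee_car:
  "z \<in> car (vee X) (a, k) \<longleftrightarrow>
     z = None \<or> (\<exists>i x. z = Some (i, x) \<and> i \<in> {1..k} \<and> x \<in> car X a \<and> x \<noteq> pt X a)"
  by (auto simp: vee_def wedge_def quot_functor_def quot_def)

lemma vee_pt: "pt (vee X) (a, k) = None"
  by (simp add: vee_def wedge_def quot_functor_def)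

lemma vee_act:
  "act (vee X) (a, k) (b, l) (f, \<phi>) None = None"
  "i \<in> {1..k} \<Longrightarrow> \<phi> i \<le> l \<Longrightarrow> act (vee X) (a, k) (b, l) (f, \<phi>) (Some (i, x)) =
     (if \<phi> i = 0 \<or> act X a b f x = pt X b then None else Some (\<phi> i, act X a b f x))"
  by (auto simp: vee_def wedge_def quot_functor_def quot_map_def quot_proj_def wedge_map_def
      wedge_in_def)

lemma is_pset_functor_vee:
  assumes X: "is_pset_functor C X"
  shows "is_pset_functor (prod_cat C Fin_pt) (vee X)"
proof -
  have Xpt: "pt X a \<in> car X a" if "a \<in> Obj C" for a
    using X that by (simp add: is_pset_functor_def)
  have Xact: "x \<in> car X a \<Longrightarrow> act X a b f x \<in> car X b" "act X a b f (pt X a) = pt X b"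
    if "a \<in> Obj C" "b \<in> Obj C" "f \<in> Hom C a b" for a b f x
    using X that by (auto simp: is_pset_functor_def Pi_iff)
  have Xid: "act X a a (Ident C a) x = x" if "a \<in> Obj C" "x \<in> car X a" for a x
    using X that by (simp add: is_pset_functor_def)
  have Xcomp: "act X a c (Comp C a b c g f) x = act X b c g (act X a b f x)"
    if "a \<in> Obj C" "b \<in> Obj C" "c \<in> Obj C" "f \<in> Hom C a b" "g \<in> Hom C b c" "x \<in> car X a"
    for a b c f g x
    using X that by (simp add: is_pset_functor_def)
  have \<phi>: "\<phi> 0 = 0" "i \<in> {1..k} \<Longrightarrow> \<phi> i \<le> l" if "\<phi> \<in> Hom Fin_pt k l" for \<phi> k l i
    using that by (auto simp: Fin_pt_def PiE_iff)
  have Comp: "Comp Fin_pt k l m \<psi> \<phi> i = \<psi> (\<phi> i)" if "i \<in> {1..k}" for k l m \<psi> \<phi> i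
    using that by (simp add: Fin_pt_def compose_def)
  have id: "Ident Fin_pt k i = i" if "i \<in> {1..k}" for k i
    using that by (simp add: Fin_pt_def)
  note prod = prod_cat_def
  show ?thesis
    unfolding is_pset_functor_def
  proof (intro conjI ballI funcsetI)
    fix A assume "A \<in> Obj (prod_cat C Fin_pt)"
    then show "pt (vee X) A \<in> car (vee X) A"
      by (cases A) (simp add: vee_pt vee_car)
  next
    fix A B F z
    assume *: "A \<in> Obj (prod_cat C Fin_pt)" "B \<in> Obj (prod_cat C Fin_pt)"
      "F \<in> Hom (prod_cat C Fin_pt) A B"
    show "act (vee X) A B F (pt (vee X) A) = pt (vee X) B"
      by (cases A; cases B; cases F) (simp add: vee_pt vee_act)
    assume z: "z \<in> car (vee X) A"
    obtain a k b l f \<phi> where A: "A = (a, k)" "B = (b, l)" "F = (f, \<phi>)"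
      by (metis surj_pair)
    show "act (vee X) A B F z \<in> car (vee X) B"
    proof (cases z)
      case (Some w)
      then obtain i x where i: "i \<in> {1..k}" and "x \<in> car X a" "z = Some (i, x)"
        using z unfolding A vee_car by blast
      moreover have "\<phi> i \<le> l" using \<phi>(2)[of \<phi> k l, OF _ i] * by (simp add: A prod)
      ultimately show ?thesis
        using * by (simp add: A prod vee_act vee_car Xact Suc_le_eq)
    qed (simp add: A vee_act vee_car)
  next
    fix A z assume "A \<in> Obj (prod_cat C Fin_pt)" "z \<in> car (vee X) A"
    moreover obtain a k where A: "A = (a, k)" by (metis surj_pair)
    ultimately have a: "a \<in> Obj C" and z: "z \<in> car (vee X) (a, k)" by (auto simp: prod)
    show "act (vee X) A A (Ident (prod_cat C Fin_pt) A) z = z"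
    proof (cases z)
      case (Some w)
      then obtain i x where "i \<in> {1..k}" "x \<in> car X a" "x \<noteq> pt X a" "z = Some (i, x)"
        using z unfolding vee_car by blast
      then show ?thesis using a by (simp add: A prod vee_act id Xid)
    qed (simp add: A prod vee_act)
  next
    fix A B D F G z
    assume *: "A \<in> Obj (prod_cat C Fin_pt)" "B \<in> Obj (prod_cat C Fin_pt)"
      "D \<in> Obj (prod_cat C Fin_pt)" "F \<in> Hom (prod_cat C Fin_pt) A B"
      "G \<in> Hom (prod_cat C Fin_pt) B D" "z \<in> car (vee X) A"
    obtain a k b l c m f \<phi> g \<psi>
      where A: "A = (a, k)" "B = (b, l)" "D = (c, m)" "F = (f, \<phi>)" "G = (g, \<psi>)"
      by (metis surj_pair)
    from * have obj: "a \<in> Obj C" "b \<in> Obj C" "c \<in> Obj C" and f: "f \<in> Hom C a b"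
      and g: "g \<in> Hom C b c" and \<phi>_Hom: "\<phi> \<in> Hom Fin_pt k l" and \<psi>_Hom: "\<psi> \<in> Hom Fin_pt l m"
      by (simp_all add: A prod)
    show "act (vee X) A D (Comp (prod_cat C Fin_pt) A B D G F) z =
        act (vee X) B D G (act (vee X) A B F z)"
    proof (cases z)
      case (Some w)
      then obtain i x where ix: "i \<in> {1..k}" "x \<in> car X a" "z = Some (i, x)"
        using *(6) unfolding A vee_car by blast
      have "\<phi> i \<le> l" using \<phi>(2)[OF \<phi>_Hom ix(1)] .
      moreover have "\<psi> (\<phi> i) \<le> m"
        using \<psi>_Hom \<open>\<phi> i \<le> l\<close> by (auto simp: Fin_pt_def PiE_iff)
      moreover have "\<psi> 0 = 0" using \<phi>(1)[OF \<psi>_Hom] .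
      ultimately show ?thesis
        using ix obj f g Xcomp[OF obj f g ix(2)] Xact(2)[OF obj(2,3) g]
        by (simp add: A prod vee_act Comp Suc_le_eq)
    qed (simp add: A prod vee_act)
  qed
qed


section \<open>Numbering the elements of the delooping\<close>

text \<open>The number of \<open>(f\<^sub>1, \<dots>, f\<^sub>n, i)\<close>, by iterated lexicographic ordering. The recursion follows
  the unfolding of \<open>\<BB>\<^sup>n \<bbbF>\<^sub>1\<close>, in which the last simplicial variable is absorbed first into the
  \<open>Fin\<^sub>*\<close> variable.\<close>

primrec lex_number :: "nat \<Rightarrow> nat list \<Rightarrow> nat \<Rightarrow> (nat \<Rightarrow> nat) list \<Rightarrow> nat \<Rightarrow> nat" where
  "lex_number 0 K m fs i = i"
| "lex_number (Suc n) K m fs i = lex_number n (butlast K) (last K * m) (butlast fs)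
     (smash_pair m (cut_index (last K) (last fs)) i)"

text \<open>The complement of the boundary, by \<open>cube_boundary_iff\<close>. The condition is stated entry by entry,
  because this is what can be split along the last simplicial variable.\<close>

definition off_boundary :: "nat \<Rightarrow> nat list \<Rightarrow> (nat \<Rightarrow> nat) list set" where
  "off_boundary n K = {fs \<in> car (cube n) K. \<forall>i<n. cut_index (K ! i) (fs ! i) \<noteq> 0}"

lemma cube_minus_boundary:
  "length K = n \<Longrightarrow> car (cube n) K - cube_boundary n K = off_boundary n K"
  by (rule set_eqI)
    (simp add: off_boundary_def cube_boundary_iff Obj_multi_Delta_op cong: conj_cong)

lemma car_cube_snoc:
  "length K = n \<Longrightarrow> fs @ [f] \<in> car (cube (Suc n)) (K @ [k]) \<longleftrightarrow>
     fs \<in> car (cube n) K \<and> f \<in> Hom Delta k 1"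
  by (auto simp: car_cube nth_append All_less_Suc)

lemma off_boundary_snoc:
  "length K = n \<Longrightarrow> fs @ [f] \<in> off_boundary (Suc n) (K @ [k]) \<longleftrightarrow>
     fs \<in> off_boundary n K \<and> f \<in> Hom Delta k 1 \<and> cut_index k f \<noteq> 0"
  by (auto simp: off_boundary_def car_cube_snoc All_less_Suc nth_append car_cube[of fs n])

lemma act_cube_snoc:
  "length L = n \<Longrightarrow> length fs = n \<Longrightarrow> length \<alpha>s = n \<Longrightarrow>
     act (cube (Suc n)) (K @ [k]) (L @ [l]) (\<alpha>s @ [\<alpha>]) (fs @ [f]) =
     act (cube n) K L \<alpha>s fs @ [compose {0..l} f \<alpha>]"
  by (simp add: act_cube nth_append)

lemma deloop_snoc:
  "car (deloop X) (K @ [k], m) = car X (K, k * m)"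
  "act (deloop X) (K @ [k], m) (L @ [l], m') (\<alpha>s @ [\<alpha>], \<phi>) =
     act X (K, k * m) (L, l * m') (\<alpha>s, smash_map k m m' (s_map k l \<alpha>) \<phi>)"
  by (simp_all add: deloop_def)

lemma smash_pair_0: "smash_pair b 0 j = 0" "smash_pair b i 0 = 0"
  by (simp_all add: smash_pair_def)

lemma lex_number_eq_0:
  "length K = n \<Longrightarrow> length fs = n \<Longrightarrow> i = 0 \<or> (\<exists>p<n. cut_index (K ! p) (fs ! p) = 0) \<Longrightarrow>
     lex_number n K m fs i = 0"
proof (induction n arbitrary: K m fs i)
  case (Suc n)
  then obtain K' k fs' f
    where K: "K = K' @ [k]" "length K' = n" and fs: "fs = fs' @ [f]" "length fs' = n"
    by (metis length_Suc_conv_rev)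
  from Suc.prems(3) K fs
  have "smash_pair m (cut_index k f) i = 0 \<or> (\<exists>p<n. cut_index (K' ! p) (fs' ! p) = 0)"
    by (auto simp: smash_pair_0 less_Suc_eq nth_append)
  from Suc.IH[OF K(2) fs(2) this] show ?case by (simp add: K fs)
qed simp

lemma smash_pair_le: "i \<le> a \<Longrightarrow> j \<le> b \<Longrightarrow> smash_pair b i j \<le> a * b"
  using bij_betw_apply[OF bij_smash_pair[of b a], of "(i, j)"]
  by (cases "i = 0 \<or> j = 0") (auto simp: smash_pair_def)

lemma smash_map_Hom:
  assumes "f \<in> Hom Fin_pt a a'" "g \<in> Hom Fin_pt b b'"
  shows "smash_map a b b' f g \<in> Hom Fin_pt (a * b) (a' * b')"
proof -
  have le: "smash_pair b' (f i) (g j) \<le> a' * b'" if "i \<le> a" "j \<le> b" for i j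
    using assms that by (intro smash_pair_le) (auto simp: Fin_pt_def PiE_iff)
  have "(x - 1) div b + 1 \<le> a \<and> (x - 1) mod b + 1 \<le> b" if "0 < x" "x \<le> a * b" for x
  proof -
    have "x - 1 < a * b" using that by simp
    moreover from this have "b > 0" by (cases b) auto
    ultimately show ?thesis by (auto simp: Suc_le_eq less_mult_imp_div_less)
  qed
  with le show ?thesis by (auto simp: Fin_pt_def smash_map_def)
qed

text \<open>Precomposing the \<open>f\<^sub>j\<close> and applying \<open>\<phi>\<close> to \<open>i\<close> is what the iterated smash product of the maps
  \<open>s(\<alpha>\<^sub>j)\<close> and \<open>\<phi>\<close> does. Absorbing the last simplicial variable replaces \<open>\<phi>\<close> by \<open>s(\<alpha>\<^sub>n) \<and> \<phi>\<close> and \<open>i\<close>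
  by the number of the pair of \<open>f\<^sub>n\<close> and \<open>i\<close>, which may be \<open>0\<close> even for \<open>i \<noteq> 0\<close>; so the induction is
  carried out for arbitrary \<open>\<phi>\<close> and all \<open>i\<close>, including \<open>0\<close>, and arbitrary \<open>f\<^sub>j\<close>.\<close>

lemma act_deloop_lex_number:
  assumes "length K = n" "length L = n" "\<alpha>s \<in> Hom (multi_Delta_op n) K L" "\<phi> \<in> Hom Fin_pt m l"
    "fs \<in> car (cube n) K" "i \<le> m"
  shows "act ((deloop ^^ n) F1) (K, m) (L, l) (\<alpha>s, \<phi>) (lex_number n K m fs i) =
    lex_number n L l (act (cube n) K L \<alpha>s fs) (\<phi> i)"
  using assms
proof (induction n arbitrary: K L \<alpha>s \<phi> m l fs i)
  case 0
  then show ?case by (simp add: F1_def)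
next
  case (Suc n)
  have len: "length \<alpha>s = Suc n" "length fs = Suc n"
    using Suc.prems by (simp_all add: Hom_multi_Delta_op car_cube)
  obtain K' k where K: "K = K' @ [k]" "length K' = n"
    using Suc.prems(1) by (auto simp: length_Suc_conv_rev)
  obtain L' k' where L: "L = L' @ [k']" "length L' = n"
    using Suc.prems(2) by (auto simp: length_Suc_conv_rev)
  obtain \<alpha>s' \<alpha> where \<alpha>s: "\<alpha>s = \<alpha>s' @ [\<alpha>]" "length \<alpha>s' = n"
    using len(1) by (auto simp: length_Suc_conv_rev)
  obtain fs' f where fs: "fs = fs' @ [f]" "length fs' = n"
    using len(2) by (auto simp: length_Suc_conv_rev)
  note snoc = K L \<alpha>s fs
  have \<alpha>s': "\<alpha>s' \<in> Hom (multi_Delta_op n) K' L'" and \<alpha>: "\<alpha> \<in> Hom Delta k' k"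
    using Suc.prems(3) snoc by (auto simp: Hom_multi_Delta_op nth_append All_less_Suc)
  have fs': "fs' \<in> car (cube n) K'" and f: "f \<in> Hom Delta k 1"
    using Suc.prems(5) snoc car_cube_snoc by auto
  have \<phi>0: "\<phi> 0 = 0" using Suc.prems(4) by (simp add: Fin_pt_def)
  have "smash_map k m l (s_map k k' \<alpha>) \<phi> (smash_pair m (cut_index k f) i)
      = smash_pair l (cut_index k' (compose {0..k'} f \<alpha>)) (\<phi> i)"
    unfolding cut_index_compose[OF \<alpha> f]
    using cut_index_le[OF f] Suc.prems(6) s_map_0[OF \<alpha>] \<phi>0 by (rule smash_map_smash_pair)
  moreover have "act ((deloop ^^ n) F1) (K', k * m) (L', k' * l)
      (\<alpha>s', smash_map k m l (s_map k k' \<alpha>) \<phi>)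
      (lex_number n K' (k * m) fs' (smash_pair m (cut_index k f) i)) =
    lex_number n L' (k' * l) (act (cube n) K' L' \<alpha>s' fs')
      (smash_map k m l (s_map k k' \<alpha>) \<phi> (smash_pair m (cut_index k f) i))"
    using Suc.IH[OF K(2) L(2) \<alpha>s' smash_map_Hom[OF s_map_functor(1)[OF \<alpha>] Suc.prems(4)] fs'
        smash_pair_le[OF cut_index_le[OF f] Suc.prems(6)]] .
  ultimately show ?case
    by (simp add: snoc deloop_snoc act_cube_snoc)
qed

text \<open>Off the basepoint, \<open>lex_number\<close> numbers the tuples without repetition: this is the bijection
  between \<open>{1..k} \<times> {1..m}\<close> and \<open>{1..k m}\<close>, applied once for each simplicial variable.\<close>

lemma bij_lex_number:
  "length K = n \<Longrightarrow> bij_betw (\<lambda>(i, fs). lex_number n K m fs i) ({1..m} \<times> off_boundary n K)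
     (car ((deloop ^^ n) F1) (K, m) - {0})"
proof (induction n arbitrary: K m)
  case 0
  have "off_boundary 0 K = {[]}" by (auto simp: off_boundary_def car_cube)
  moreover have "bij_betw (\<lambda>(i, fs). i) ({1..m} \<times> {[]}) {1..m}"
    by (rule bij_betw_byWitness[where f' = "\<lambda>i. (i, [])"]) auto
  moreover have "{0..m} - {0} = {1..m}" by auto
  ultimately show ?case using 0 by (simp add: F1_def)
next
  case (Suc n)
  then obtain K' k where K: "K = K' @ [k]" "length K' = n"
    by (metis length_Suc_conv_rev)
  let ?N = "{f \<in> Hom Delta k 1. cut_index k f \<noteq> 0}"
  have snoc: "bij_betw (\<lambda>(i, fs). (i, butlast fs, last fs)) ({1..m} \<times> off_boundary (Suc n) K)
      ({1..m} \<times> off_boundary n K' \<times> ?N)"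
  proof (rule bij_betw_byWitness[where f' = "\<lambda>(i, fs, f). (i, fs @ [f])"])
    have "\<exists>fs' f. fs = fs' @ [f] \<and> fs' \<in> off_boundary n K' \<and> f \<in> ?N"
      if fs: "fs \<in> off_boundary (Suc n) K" for fs
    proof -
      obtain fs' f where "fs = fs' @ [f]"
        using fs
        by (metis (mono_tags, lifting) off_boundary_def car_cube length_Suc_conv_rev mem_Collect_eq)
      then show ?thesis using fs off_boundary_snoc K by auto
    qed
    note elem = this
    show "(\<lambda>(i, fs). (i, butlast fs, last fs)) ` ({1..m} \<times> off_boundary (Suc n) K)
        \<subseteq> {1..m} \<times> off_boundary n K' \<times> ?N"
      using elem by fastforce
    show "\<forall>a\<in>{1..m} \<times> off_boundary (Suc n) K.
        (\<lambda>(i, fs, f). (i, fs @ [f])) ((\<lambda>(i, fs). (i, butlast fs, last fs)) a) = a"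
      using elem by fastforce
  qed (auto simp: K off_boundary_snoc)
  have smash: "bij_betw (\<lambda>(i, fs, f). (smash_pair m (cut_index k f) i, fs))
      ({1..m} \<times> off_boundary n K' \<times> ?N) ({1..k * m} \<times> off_boundary n K')"
  proof -
    have "bij_betw ((\<lambda>(c, i). smash_pair m c i) \<circ> map_prod (cut_index k) id)
        (?N \<times> {1..m}) {1..k * m}"
      by (intro bij_betw_trans[OF bij_betw_map_prod[OF bij_cut_index bij_betw_id] bij_smash_pair])
    then have g: "bij_betw (\<lambda>(f, i). smash_pair m (cut_index k f) i) (?N \<times> {1..m}) {1..k * m}"
      by (simp add: comp_def case_prod_unfold)
    have "bij_betw (\<lambda>(i, fs, f). ((f, i), fs)) ({1..m} \<times> off_boundary n K' \<times> ?N)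
        ((?N \<times> {1..m}) \<times> off_boundary n K')"
      by (rule bij_betw_byWitness[where f' = "\<lambda>((f, i), fs). (i, fs, f)"]) auto
    from bij_betw_trans[OF this bij_betw_map_prod[OF g bij_betw_id]]
    show ?thesis by (simp add: comp_def case_prod_unfold map_prod_def)
  qed
  have "bij_betw ((\<lambda>(i, fs). lex_number n K' (k * m) fs i) \<circ>
      ((\<lambda>(i, fs, f). (smash_pair m (cut_index k f) i, fs)) \<circ> (\<lambda>(i, fs). (i, butlast fs, last fs))))
      ({1..m} \<times> off_boundary (Suc n) K) (car ((deloop ^^ n) F1) (K', k * m) - {0})"
    by (intro bij_betw_trans[OF bij_betw_trans[OF snoc smash]] Suc.IH K)
  then show ?case
    by (simp add: K deloop_snoc comp_def case_prod_unfold)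
qed

lemma pt_deloop: "pt ((deloop ^^ n) F1) (K, m) = 0"
proof (induction n arbitrary: K m)
  case (Suc n)
  have "pt (deloop X) (K, m) = pt X (butlast K, last K * m)" for X :: "nat gamma"
    by (simp add: deloop_def)
  with Suc show ?case by simp
qed (simp add: F1_def)

lemma zero_in_car_deloop: "0 \<in> car ((deloop ^^ n) F1) (K, m)"
proof (induction n arbitrary: K m)
  case (Suc n)
  have "car (deloop X) (K, m) = car X (butlast K, last K * m)" for X :: "nat gamma"
    by (simp add: deloop_def)
  with Suc show ?case by simp
qed (simp add: F1_def)


section \<open>The comparison\<close>

text \<open>The functor laws hold on one side of a bijection compatible with the structure maps as soon as
  they hold on the other: every element of \<open>X\<close> has the form \<open>\<epsilon> y\<close>, and there \<open>X\<close> acts as \<open>Y\<close> does.\<close>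

lemma is_pset_functor_transport:
  assumes C: "is_category C" and Y: "is_pset_functor C Y" and \<epsilon>: "is_pset_nat_iso C Y X \<epsilon>"
  shows "is_pset_functor C X"
proof -
  have elem: "\<exists>y. y \<in> car Y a \<and> x = \<epsilon> a y" if "a \<in> Obj C" "x \<in> car X a" for a x
    using \<epsilon> that unfolding is_pset_nat_iso_def bij_betw_def by blast
  have car: "\<epsilon> a y \<in> car X a" if "a \<in> Obj C" "y \<in> car Y a" for a y
    using \<epsilon> that unfolding is_pset_nat_iso_def is_pset_nat_trans_def by blast
  have pt: "pt X a = \<epsilon> a (pt Y a)" if "a \<in> Obj C" for a
    using \<epsilon> that unfolding is_pset_nat_iso_def is_pset_nat_trans_def by simp
  have act: "act X a b f (\<epsilon> a y) = \<epsilon> b (act Y a b f y)"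
    if "a \<in> Obj C" "b \<in> Obj C" "f \<in> Hom C a b" "y \<in> car Y a" for a b f y
    using \<epsilon> that unfolding is_pset_nat_iso_def is_pset_nat_trans_def by simp
  have Ypt: "pt Y a \<in> car Y a" if "a \<in> Obj C" for a
    using Y that by (simp add: is_pset_functor_def)
  have Yact: "y \<in> car Y a \<Longrightarrow> act Y a b f y \<in> car Y b" "act Y a b f (pt Y a) = pt Y b"
    if "a \<in> Obj C" "b \<in> Obj C" "f \<in> Hom C a b" for a b f y
    using Y that by (auto simp: is_pset_functor_def Pi_iff)
  show ?thesis
    unfolding is_pset_functor_def
  proof (intro conjI ballI funcsetI)
    fix a b f x assume *: "a \<in> Obj C" "b \<in> Obj C" "f \<in> Hom C a b" "x \<in> car X a"
    with elem obtain y where "y \<in> car Y a" "x = \<epsilon> a y" by blast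
    with * show "act X a b f x \<in> car X b" by (simp add: act car Yact)
  next
    fix a x assume *: "a \<in> Obj C" "x \<in> car X a"
    with elem obtain y where "y \<in> car Y a" "x = \<epsilon> a y" by blast
    moreover have "Ident C a \<in> Hom C a a" using C * by (simp add: is_category_def)
    ultimately show "act X a a (Ident C a) x = x"
      using Y * by (simp add: act is_pset_functor_def)
  next
    fix a b c f g x
    assume *: "a \<in> Obj C" "b \<in> Obj C" "c \<in> Obj C" "f \<in> Hom C a b" "g \<in> Hom C b c" "x \<in> car X a"
    with elem obtain y where y: "y \<in> car Y a" "x = \<epsilon> a y" by blast
    have "Comp C a b c g f \<in> Hom C a c"
      using C * unfolding is_category_def by blast
    moreover have "act Y a c (Comp C a b c g f) y = act Y b c g (act Y a b f y)"
      using Y * y unfolding is_pset_functor_def by blast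
    ultimately show "act X a c (Comp C a b c g f) x = act X b c g (act X a b f x)"
      using * y by (simp add: act Yact)
  qed (simp_all add: pt Ypt car act Yact)
qed

lemma is_pset_nat_iso_inverse:
  assumes Y: "is_pset_functor C Y" and \<epsilon>: "is_pset_nat_iso C Y X \<epsilon>"
  shows "is_pset_nat_iso C X Y (\<lambda>a. inv_into (car Y a) (\<epsilon> a))"
proof -
  have bij: "bij_betw (\<epsilon> a) (car Y a) (car X a)" if "a \<in> Obj C" for a
    using \<epsilon> that by (simp add: is_pset_nat_iso_def)
  have inv: "inv_into (car Y a) (\<epsilon> a) (\<epsilon> a y) = y" if "a \<in> Obj C" "y \<in> car Y a" for a y
    using bij_betw_inv_into_left[OF bij] that .
  have elem: "\<exists>y. y \<in> car Y a \<and> x = \<epsilon> a y" if "a \<in> Obj C" "x \<in> car X a" for a x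
    using bij that unfolding bij_betw_def by blast
  have bij': "bij_betw (inv_into (car Y a) (\<epsilon> a)) (car X a) (car Y a)" if "a \<in> Obj C" for a
    using bij[OF that] by (rule bij_betw_inv_into)
  show ?thesis
    unfolding is_pset_nat_iso_def is_pset_nat_trans_def
  proof (intro conjI ballI)
    fix a assume a: "a \<in> Obj C"
    show "inv_into (car Y a) (\<epsilon> a) \<in> car X a \<rightarrow> car Y a"
      using bij'[OF a] by (rule bij_betw_imp_funcset)
    show "inv_into (car Y a) (\<epsilon> a) (pt X a) = pt Y a"
      using \<epsilon> Y a inv[of a "pt Y a"]
      by (simp add: is_pset_nat_iso_def is_pset_nat_trans_def is_pset_functor_def)
  next
    fix a b f x assume *: "a \<in> Obj C" "b \<in> Obj C" "f \<in> Hom C a b" "x \<in> car X a"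
    with elem obtain y where y: "y \<in> car Y a" "x = \<epsilon> a y" by blast
    have "act Y a b f y \<in> car Y b"
      using Y * y by (auto simp: is_pset_functor_def Pi_iff)
    moreover have "\<epsilon> b (act Y a b f y) = act X a b f (\<epsilon> a y)"
      using \<epsilon> * y by (simp add: is_pset_nat_iso_def is_pset_nat_trans_def)
    ultimately show "inv_into (car Y b) (\<epsilon> b) (act X a b f x) =
        act Y a b f (inv_into (car Y a) (\<epsilon> a) x)"
      using * y inv by metis
  qed (rule bij')
qed

lemma gamma_isomorphic_by_inverse:
  assumes Y: "gamma_object n Y"
    and \<epsilon>: "is_pset_nat_iso (prod_cat (multi_Delta_op n) Fin_pt) Y X \<epsilon>"
  shows "gamma_isomorphic n X Y"
proof -
  let ?C = "prod_cat (multi_Delta_op n) Fin_pt"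
  have Y_laws: "is_pset_functor ?C Y" using Y by (simp add: gamma_object_def)
  have "is_category ?C"
    by (intro is_category_prod is_category_multi_Delta_op is_category_Fin_pt)
  then have "is_pset_functor ?C X"
    using Y_laws \<epsilon> by (rule is_pset_functor_transport)
  moreover have "car X (K, 0) = {pt X (K, 0)}" if "K \<in> Obj (multi_Delta_op n)" for K
  proof -
    have "(K, 0) \<in> Obj ?C" using that by (simp add: prod_cat_def Fin_pt_def)
    with \<epsilon> have "\<epsilon> (K, 0) ` car Y (K, 0) = car X (K, 0)" "\<epsilon> (K, 0) (pt Y (K, 0)) = pt X (K, 0)"
      by (simp_all add: is_pset_nat_iso_def is_pset_nat_trans_def bij_betw_def)
    then show ?thesis using Y that by (auto simp: gamma_object_def)
  qed
  ultimately have "gamma_object n X" by (simp add: gamma_object_def)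
  with Y is_pset_nat_iso_inverse[OF Y_laws \<epsilon>] show ?thesis
    unfolding gamma_isomorphic_def by blast
qed

text \<open>Here \<open>(i, None)\<close>, the basepoint of the \<open>i\<close>-th summand, is not an element of the wedge.\<close>

definition wedge_number :: "nat \<Rightarrow> nat list \<times> nat \<Rightarrow> (nat \<times> (nat \<Rightarrow> nat) list option) option \<Rightarrow> nat"
  where
  "wedge_number n = (\<lambda>(K, m) z.
     case z of Some (i, Some fs) \<Rightarrow> lex_number n K m fs i | _ \<Rightarrow> 0)"

lemma wedge_number_simps:
  "wedge_number n (K, m) None = 0"
  "wedge_number n (K, m) (Some (i, Some fs)) = lex_number n K m fs i"
  by (simp_all add: wedge_number_def)

lemma car_sphere: "length K = n \<Longrightarrow> car (sphere n) K = insert None (Some ` off_boundary n K)"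
  by (simp add: sphere_def quot_functor_def quot_def cube_minus_boundary)

lemma pt_sphere: "pt (sphere n) K = None"
  by (simp add: sphere_def quot_functor_def)

lemma car_vee_sphere:
  "length K = n \<Longrightarrow> car (vee (sphere n)) (K, m) =
     insert None ((\<lambda>(i, fs). Some (i, Some fs)) ` ({1..m} \<times> off_boundary n K))"
  by (rule set_eqI) (auto simp: vee_car car_sphere pt_sphere)

lemma bij_wedge_number:
  assumes "length K = n"
  shows "bij_betw (wedge_number n (K, m)) (car (vee (sphere n)) (K, m))
    (car ((deloop ^^ n) F1) (K, m))"
proof -
  let ?X = "car ((deloop ^^ n) F1) (K, m)"
  let ?T = "{1..m} \<times> off_boundary n K"
  let ?S = "(\<lambda>(i, fs). Some (i, Some fs)) ` ?T"
  have eq: "wedge_number n (K, m) \<circ> (\<lambda>(i, fs). Some (i, Some fs)) = (\<lambda>(i, fs). lex_number n K m fs i)"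
    by (auto simp: wedge_number_simps)
  have "bij_betw (\<lambda>(i, fs). Some (i, Some fs)) ?T ?S"
    by (intro bij_betw_imageI inj_onI) auto
  then have "bij_betw (wedge_number n (K, m)) ?S (?X - {0})"
    using bij_lex_number[OF assms, of m] by (simp add: bij_betw_comp_iff eq)
  moreover have "bij_betw (wedge_number n (K, m)) {None} {0}"
    by (simp add: wedge_number_simps)
  ultimately have "bij_betw (wedge_number n (K, m)) ({None} \<union> ?S) ({0} \<union> (?X - {0}))"
    by (intro bij_betw_combine) auto
  moreover have "{0} \<union> (?X - {0}) = ?X" using zero_in_car_deloop by auto
  ultimately show ?thesis by (simp add: car_vee_sphere assms)
qed

lemma wedge_number_natural:
  assumes len: "length K = n" "length L = n" and \<alpha>s: "\<alpha>s \<in> Hom (multi_Delta_op n) K L"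
    and \<phi>: "\<phi> \<in> Hom Fin_pt m l" and z: "z \<in> car (vee (sphere n)) (K, m)"
  shows "wedge_number n (L, l) (act (vee (sphere n)) (K, m) (L, l) (\<alpha>s, \<phi>) z) =
    act ((deloop ^^ n) F1) (K, m) (L, l) (\<alpha>s, \<phi>) (wedge_number n (K, m) z)"
proof (cases z)
  case None
  \<comment> \<open>The basepoint is also the number of any tuple with \<open>i = 0\<close>.\<close>
  obtain fs where fs: "fs \<in> car (cube n) K"
    using constant_in_cube[OF len(1)] by blast
  have "act ((deloop ^^ n) F1) (K, m) (L, l) (\<alpha>s, \<phi>) 0 = 0"
    using act_deloop_lex_number[OF len \<alpha>s \<phi> fs, of 0] \<phi> fs len
    by (simp add: lex_number_eq_0 Fin_pt_def car_cube act_cube)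
  then show ?thesis by (simp add: None vee_act wedge_number_simps)
next
  case (Some w)
  then obtain i fs where z_eq: "z = Some (i, Some fs)" and i: "i \<in> {1..m}"
    and fs: "fs \<in> off_boundary n K"
    using z car_vee_sphere[OF len(1)] by auto
  let ?gs = "act (cube n) K L \<alpha>s fs"
  have fs_cube: "fs \<in> car (cube n) K" using fs by (simp add: off_boundary_def)
  have gs: "?gs \<in> car (cube n) L"
    using act_cube_car[OF _ _ \<alpha>s fs_cube] len by (simp add: Obj_multi_Delta_op)
  have \<phi>i: "\<phi> i \<le> l" using \<phi> i by (auto simp: Fin_pt_def PiE_iff)
  have "act (sphere n) K L \<alpha>s (Some fs) = (if ?gs \<in> cube_boundary n L then None else Some ?gs)"
    by (simp add: sphere_def quot_functor_def quot_map_def quot_proj_def)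
  moreover have "lex_number n L l ?gs (\<phi> i) = 0" if "\<phi> i = 0 \<or> ?gs \<in> cube_boundary n L"
    using that gs len cube_boundary_iff[OF _ gs]
    by (intro lex_number_eq_0) (auto simp: Obj_multi_Delta_op car_cube)
  ultimately have "wedge_number n (L, l) (act (vee (sphere n)) (K, m) (L, l) (\<alpha>s, \<phi>) z)
      = lex_number n L l ?gs (\<phi> i)"
    using i \<phi>i by (auto simp: z_eq vee_act pt_sphere wedge_number_simps)
  then show ?thesis
    using act_deloop_lex_number[OF len \<alpha>s \<phi> fs_cube, of i] i by (simp add: z_eq wedge_number_simps)
qed

theorem theorem4p5:
  fixes n :: nat
  shows "gamma_isomorphic n ((deloop ^^ n) F1) (vee (sphere n))"
proof (rule gamma_isomorphic_by_inverse)
  show "gamma_object n (vee (sphere n))"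
    unfolding gamma_object_def
    by (simp add: is_pset_functor_vee is_pset_functor_sphere Obj_multi_Delta_op car_vee_sphere vee_pt)
  show "is_pset_nat_iso (prod_cat (multi_Delta_op n) Fin_pt) (vee (sphere n))
      ((deloop ^^ n) F1) (wedge_number n)"
    unfolding is_pset_nat_iso_def is_pset_nat_trans_def
  proof (intro conjI ballI)
    fix A assume "A \<in> Obj (prod_cat (multi_Delta_op n) Fin_pt)"
    then obtain K m where A: "A = (K, m)" "length K = n"
      by (cases A) (auto simp: prod_cat_def Obj_multi_Delta_op)
    show bij: "bij_betw (wedge_number n A) (car (vee (sphere n)) A) (car ((deloop ^^ n) F1) A)"
      using bij_wedge_number A by simp
    then show "wedge_number n A \<in> car (vee (sphere n)) A \<rightarrow> car ((deloop ^^ n) F1) A"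
      by (rule bij_betw_imp_funcset)
    show "wedge_number n A (pt (vee (sphere n)) A) = pt ((deloop ^^ n) F1) A"
      by (simp add: A vee_pt pt_deloop wedge_number_simps)
  next
    fix A B F z
    assume "A \<in> Obj (prod_cat (multi_Delta_op n) Fin_pt)"
      "B \<in> Obj (prod_cat (multi_Delta_op n) Fin_pt)"
      "F \<in> Hom (prod_cat (multi_Delta_op n) Fin_pt) A B" "z \<in> car (vee (sphere n)) A"
    then show "wedge_number n B (act (vee (sphere n)) A B F z) =
        act ((deloop ^^ n) F1) A B F (wedge_number n A z)"
      by (cases A; cases B; cases F)
        (auto simp: prod_cat_def Obj_multi_Delta_op intro!: wedge_number_natural)
  qed
qed

end
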